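(* Let $p$ be a prime number, let $n\geqslant 3$ be a proper divisor of $p-1$, and let $k=(p-1)/n$. Let $A=A_1A_2\ldots A_k$ be an affinely regular $k$-gon inscribed in a hyperbola $\mathcal{H}$ of the affine plane $\mathbb{A}^2(\mathbb{F}_p)$, with affine coordinates chosen so that $\mathcal{H}$ has equation $XY=1$. Let $P=(a,b)\in\mathbb{A}^2(\mathbb{F}_p)$ be a point with $ab\notin\{0,1\}$, and let $n_P$ be the number of chords of $A$ passing through $P$. If $$p-1\leqslant n\left(\frac{(n+3)(n+4)(3n-1)}{12}-3\right),$$ then $$n_P\leqslant\frac12\left(3\,(2^{1/2}k)^{2/3}-\frac{103}{19}\,(2^{1/2}k)^{1/3}+\frac{13}{3}\right).$$
   Context: A (nondegenerate) $k$-gon in $\mathbb{A}^2(\mathbb{F}_p)$ is a set of $k$ pairwise distinct points (its vertices) arranged in a cyclic order such that no three vertices are collinear. Its chords are its sides and diagonals, i.e. the lines joining two distinct vertices. If $R_1R_2\ldots R_k$ is a regular $k$-gon in the Euclidean plane, a $k$-gon $B_1B_2\ldots B_k$ in $\mathbb{A}^2(\mathbb{F}_p)$ is called affinely regular if the bijection $R_i\mapsto B_i$ preserves all parallelisms between chords: for all $i_0<j_0$ and $i_1<j_1$ in $\{1,\ldots,k\}$, $R_{i_0}R_{j_0}\parallel R_{i_1}R_{j_1}$ if and only if $B_{i_0}B_{j_0}\parallel B_{i_1}B_{j_1}$. A polygon is inscribed in a conic if all its vertices lie on the conic. A hyperbola in $\mathbb{A}^2(\mathbb{F}_p)$ is a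 nondegenerate conic with two distinct $\mathbb{F}_p$-rational points at infinity; after an affine change of coordinates it has equation $XY=1$. *)

theory Defs
  imports Complex_Main "HOL-Library.Cardinality" "HOL-Computational_Algebra.Primes"
begin

text \<open>
  The affine plane over a field is represented by pairs of coordinates, so that the notions
  below apply both to the Euclidean plane and to the plane over a finite field.
\<close>

definition line_through :: "'a::field \<times> 'a \<Rightarrow> 'a \<times> 'a \<Rightarrow> ('a \<times> 'a) set" where
  "line_through P Q =
    {(fst P + t * (fst Q - fst P), snd P + t * (snd Q - snd P)) | t. True}"

definition aff_collinear :: "('a::field \<times> 'a) set \<Rightarrow> bool" where
  "aff_collinear S \<longleftrightarrow> (\<exists>P Q. P \<noteq> Q \<and> S \<subseteq> line_through P Q)"

definition parallel :: "('a::field \<times> 'a) set \<Rightarrow> ('a \<times> 'a) set \<Rightarrow> bool" where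
  "parallel L M \<longleftrightarrow> L = M \<or> L \<inter> M = {}"

text \<open>
  A polygon is given by its sequence of vertices \<open>B 1, \<dots>, B k\<close>; values of \<open>B\<close> outside
  \<open>{1..k}\<close> are irrelevant.
\<close>

definition polygon :: "nat \<Rightarrow> (nat \<Rightarrow> 'a::field \<times> 'a) \<Rightarrow> bool" where
  "polygon k B \<longleftrightarrow> inj_on B {1..k} \<and>
    (\<forall>i\<in>{1..k}. \<forall>j\<in>{1..k}. \<forall>l\<in>{1..k}.
       i \<noteq> j \<and> i \<noteq> l \<and> j \<noteq> l \<longrightarrow> \<not> aff_collinear {B i, B j, B l})"

definition chords :: "nat \<Rightarrow> (nat \<Rightarrow> 'a::field \<times> 'a) \<Rightarrow> ('a \<times> 'a) set set" where
  "chords k B = {line_through (B i) (B j) | i j. 1 \<le> i \<and> i < j \<and> j \<le> k}"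

text \<open>
  The centre \<open>(c, d)\<close>, the circumradius \<open>r\<close> and the phase \<open>\<theta>\<close> are arbitrary; the sign \<open>s\<close>
  allows for both orientations of the cyclic order.
\<close>

definition regular_polygon :: "nat \<Rightarrow> (nat \<Rightarrow> real \<times> real) \<Rightarrow> bool" where
  "regular_polygon k R \<longleftrightarrow>
    (\<exists>c d r \<theta> s. r > 0 \<and> s \<in> {1, -1} \<and>
      (\<forall>i\<in>{1..k}. R i = (c + r * cos (\<theta> + s * (2 * pi * real i / real k)),
                         d + r * sin (\<theta> + s * (2 * pi * real i / real k)))))"

definition affinely_regular :: "nat \<Rightarrow> (nat \<Rightarrow> 'a::field \<times> 'a) \<Rightarrow> bool" where
  "affinely_regular k B \<longleftrightarrow> polygon k B \<and>
    (\<exists>R. regular_polygon k R \<and>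
      (\<forall>i0 j0 i1 j1. 1 \<le> i0 \<and> i0 < j0 \<and> j0 \<le> k \<and> 1 \<le> i1 \<and> i1 < j1 \<and> j1 \<le> k \<longrightarrow>
        (parallel (line_through (R i0) (R j0)) (line_through (R i1) (R j1)) \<longleftrightarrow>
         parallel (line_through (B i0) (B j0)) (line_through (B i1) (B j1)))))"

definition unit_hyperbola :: "('a::field \<times> 'a) set" where
  "unit_hyperbola = {(x, y). x * y = 1}"

end

theory Submission
  imports Defs "Jordan_Normal_Form.Determinant"
begin

text \<open>
  For \<open>k \<ge> 5\<close> the parallelism conditions force the abscissas of the vertices into a geometric
  progression, so that they all satisfy \<open>x ^ k = c\<close>. A chord through \<open>(a, b)\<close> joins vertices whose
  abscissas \<open>x\<close>, \<open>y\<close> satisfy \<open>y = (x - a) / (b * x - 1)\<close>, and the chords through a given point have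
  disjoint pairs of end points. Hence \<open>2 * n_P\<close> is at most the number \<open>N\<close> of \<open>x\<close> with \<open>x ^ k = c\<close> and
  \<open>(x - a) ^ k = d * (x - \<beta>) ^ k\<close>, where \<open>\<beta> = 1 / b\<close> and \<open>d = c * b ^ k\<close>.

  To bound \<open>N\<close> take the \<open>(s + 1)\<^sup>2\<close> polynomials \<open>x ^ (k * i) * (x - a) ^ (k * j) * (x - \<beta>) ^ (k * (s - j))\<close>
  with \<open>i, j \<le> s\<close>, and put \<open>M = (s + 1)\<^sup>2 - 1\<close>. At all \<open>N\<close> points their vectors of values are proportional,
  so the determinant \<open>W\<close> whose first column holds their values at one of the points and whose other columns are
  their derivatives of order \<open>0, \<dots>, M - 1\<close> vanishes to order at least \<open>M\<close> at each of them.
  Bases of the same space adapted to \<open>0\<close>, \<open>a\<close>, \<open>\<beta>\<close> and \<open>\<infinity>\<close> show that \<open>W\<close> has high order at the first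
  three places and low degree. Since all degrees stay below \<open>p\<close>, \<open>W\<close> is not zero, and comparing its degree with
  the number of its zeros gives \<open>N * (s + 2) + s \<le> 2 * k + s ^ 3 + 2 * s\<^sup>2\<close>. Using bidegree \<open>(s, s)\<close> instead
  of total degree \<open>s\<close> leaves enough room to restrict to \<open>2 * s \<le> n\<close>, which guarantees the degree condition.
\<close>

subsection \<open>Wronskians of polynomials in small degree\<close>

text \<open>Linearity over the constants only: derivatives, and evaluation at a point read as a
  constant polynomial, are both instances, so one change-of-family lemma covers all columns used
  later.\<close>

definition linear_on_polys :: "('a::field poly \<Rightarrow> 'a poly) \<Rightarrow> bool" where
  "linear_on_polys \<Lambda> \<longleftrightarrow>
    (\<forall>f g. \<Lambda> (f + g) = \<Lambda> f + \<Lambda> g) \<and> (\<forall>c f. \<Lambda> (smult c f) = smult c (\<Lambda> f))"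

definition lin_indep :: "nat \<Rightarrow> (nat \<Rightarrow> 'a::field poly) \<Rightarrow> bool" where
  "lin_indep n F \<longleftrightarrow> (\<forall>c. (\<Sum>m<n. smult (c m) (F m)) = 0 \<longrightarrow> (\<forall>m<n. c m = 0))"

lemma linear_on_polys_sum:
  assumes "linear_on_polys \<Lambda>"
  shows "\<Lambda> (\<Sum>j<(n::nat). smult (c j) (F j)) = (\<Sum>j<n. smult (c j) (\<Lambda> (F j)))"
proof -
  have "\<Lambda> 0 = 0"
    using assms by (metis linear_on_polys_def add_cancel_right_right)
  then show ?thesis
    using assms by (induction n) (auto simp: linear_on_polys_def)
qed

lemma linear_higher_pderiv: "linear_on_polys (pderiv ^^ n)"
  by (simp add: linear_on_polys_def higher_pderiv_add higher_pderiv_smult)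

lemma linear_poly_eval: "linear_on_polys (\<lambda>f. [:poly f x:])"
  by (simp add: linear_on_polys_def)

section \<open>Determinants under a change of family\<close>

lemma det_const_mat: "det (map_mat (\<lambda>c::'a::field. [:c:]) C) = [:det C:]"
proof -
  interpret comm_ring_hom "\<lambda>c::'a. [:c:]"
    by unfold_locales (auto simp: one_pCons)
  show ?thesis by (rule hom_det)
qed

text \<open>The coefficients are constants and pass through every \<open>\<Lambda> l\<close>, so the
  matrix is the product of the coefficient matrix with the matrix for \<open>F\<close>.\<close>

lemma det_change_of_family:
  fixes F G :: "nat \<Rightarrow> 'a::field poly"
  assumes lin: "\<And>l. l < n \<Longrightarrow> linear_on_polys (\<Lambda> l)"
    and G: "\<And>m. m < n \<Longrightarrow> G m = (\<Sum>j<n. smult (C m j) (F j))"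
  shows "det (mat n n (\<lambda>(m, l). \<Lambda> l (G m))) =
    smult (det (mat n n (\<lambda>(m, j). C m j))) (det (mat n n (\<lambda>(m, l). \<Lambda> l (F m))))"
proof -
  let ?C = "mat n n (\<lambda>(m, j). C m j)"
  let ?C' = "map_mat (\<lambda>c. [:c:]) ?C"
  let ?F = "mat n n (\<lambda>(m, l). \<Lambda> l (F m))"
  have "mat n n (\<lambda>(m, l). \<Lambda> l (G m)) = ?C' * ?F"
    by (rule eq_matI)
      (auto simp: G linear_on_polys_sum lin scalar_prod_def atLeast0LessThan)
  then have "det (mat n n (\<lambda>(m, l). \<Lambda> l (G m))) = det ?C' * det ?F"
    by (simp add: det_mult[of _ n])
  then show ?thesis
    by (simp add: det_const_mat)
qed

text \<open>A kernel vector of the transposed coefficient matrix would be a linear relation among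
  the \<open>G m\<close>.\<close>

lemma det_coeffs_nonzero:
  fixes F G :: "nat \<Rightarrow> 'a::field poly"
  assumes indep: "lin_indep n G"
    and G: "\<And>m. m < n \<Longrightarrow> G m = (\<Sum>j<n. smult (C m j) (F j))"
  shows "det (mat n n (\<lambda>(m, j). C m j)) \<noteq> 0"
proof
  let ?C = "mat n n (\<lambda>(m, j). C m j)"
  assume "det ?C = 0"
  then have "det (transpose_mat ?C) = 0"
    by (simp add: det_transpose[of _ n])
  moreover have "transpose_mat ?C \<in> carrier_mat n n" by simp
  ultimately obtain v where v: "v \<in> carrier_vec n" "v \<noteq> 0\<^sub>v n"
    and eq: "transpose_mat ?C *\<^sub>v v = 0\<^sub>v n"
    using det_0_iff_vec_prod_zero_field by blast
  have z: "(\<Sum>m<n. v $ m * C m j) = 0" if "j < n" for j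
  proof -
    have "(transpose_mat ?C *\<^sub>v v) $ j = 0" using eq that by simp
    then show ?thesis
      using that v by (simp add: scalar_prod_def atLeast0LessThan mult.commute)
  qed
  have "(\<Sum>m<n. smult (v $ m) (G m)) = (\<Sum>m<n. \<Sum>j<n. smult (v $ m * C m j) (F j))"
  proof (rule sum.cong[OF refl])
    fix m assume "m \<in> {..<n}"
    then have "smult (v $ m) (G m) = smult (v $ m) (\<Sum>j<n. smult (C m j) (F j))"
      using G by simp
    also have "\<dots> = (\<Sum>j<n. smult (v $ m * C m j) (F j))"
      by (subst linear_on_polys_sum[where \<Lambda> = "smult (v $ m)"])
        (auto simp: linear_on_polys_def smult_add_right mult.commute)
    finally show "smult (v $ m) (G m) = (\<Sum>j<n. smult (v $ m * C m j) (F j))" .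
  qed
  also have "\<dots> = (\<Sum>j<n. \<Sum>m<n. smult (v $ m * C m j) (F j))"
    by (rule sum.swap)
  also have "\<dots> = (\<Sum>j<n. smult (\<Sum>m<n. v $ m * C m j) (F j))"
    by (simp add: smult_sum)
  also have "\<dots> = 0" using z by simp
  finally have "\<forall>m<n. v $ m = 0"
    using indep unfolding lin_indep_def by blast
  then have "v = 0\<^sub>v n" using v by auto
  with v show False by simp
qed

section \<open>Leading coefficients and non-vanishing of Wronskians\<close>

lemma det_scale_columns:
  fixes f :: "nat \<Rightarrow> nat \<Rightarrow> 'b::comm_ring_1"
  shows "det (mat n n (\<lambda>(m, l). r l * f m l)) = (\<Prod>l<n. r l) * det (mat n n (\<lambda>(m, l). f m l))"
proof -
  have "(\<Prod>i = 0..<n. r (\<pi> i) * f i (\<pi> i)) = (\<Prod>l<n. r l) * (\<Prod>i = 0..<n. f i (\<pi> i))"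
    if "\<pi> permutes {0..<n}" for \<pi>
  proof -
    have "(\<Prod>i = 0..<n. r (\<pi> i)) = (\<Prod>l<n. r l)"
      using prod.permute[OF that, of r] by (simp add: atLeast0LessThan comp_def)
    then show ?thesis by (simp add: prod.distrib)
  qed
  moreover have "mat n n (\<lambda>(m, l). r l * f m l) $$ (i, \<pi> i) = r (\<pi> i) * f i (\<pi> i)"
    "mat n n (\<lambda>(m, l). f m l) $$ (i, \<pi> i) = f i (\<pi> i)"
    if "\<pi> permutes {0..<n}" "i \<in> {0..<n}" for \<pi> i
    using that permutes_in_image[OF that(1), of i] by auto
  ultimately show ?thesis
    by (simp add: det_def sum_distrib_left mult_ac cong: prod.cong)
      (intro sum.cong, auto simp: mult_ac)
qed

text \<open>The falling factorial X(X - 1)...(X - l + 1): its value at \<open>n\<close> is the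
  factor by which \<open>x ^ l\<close> times the \<open>l\<close>-th derivative multiplies
  \<open>x ^ n\<close>.\<close>

definition falling_poly :: "nat \<Rightarrow> 'a::field poly" where
  "falling_poly l = (\<Prod>i<l. [:- of_nat i, 1:])"

lemma degree_falling_poly: "degree (falling_poly l :: 'a::field poly) = l"
  unfolding falling_poly_def by (subst degree_prod_eq_sum_degree) auto

lemma lead_coeff_falling_poly: "coeff (falling_poly l :: 'a::field poly) l = 1"
proof -
  have "lead_coeff (falling_poly l :: 'a poly) = 1"
    unfolding falling_poly_def by (simp add: lead_coeff_prod)
  then show ?thesis by (simp add: degree_falling_poly)
qed

lemma falling_poly_combination_zero:
  fixes v :: "nat \<Rightarrow> 'a::field"
  assumes "(\<Sum>l<n. smult (v l) (falling_poly l)) = 0" "l < n"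
  shows "v l = 0"
  using assms
proof (induction n)
  case (Suc n)
  have "coeff (\<Sum>l<n. smult (v l) (falling_poly l)) n = 0"
    by (auto simp: coeff_sum coeff_eq_0 degree_falling_poly)
  then have "v n = 0"
    using arg_cong[OF Suc.prems(1), of "\<lambda>f. coeff f n"]
    by (simp add: lead_coeff_falling_poly)
  then show ?case
    using Suc by (auto simp: less_Suc_eq)
qed simp

text \<open>
  Multiplying the \<open>l\<close>-th derivative by \<open>x ^ l\<close> turns Wronskian columns into operators that preserve
  degrees and orders of vanishing, which avoids all truncated exponents.
\<close>

lemma coeff_euler_pderiv:
  fixes f :: "'a::field poly"
  shows "coeff (monom 1 l * (pderiv ^^ l) f) n = poly (falling_poly l) (of_nat n) * coeff f n"
proof (cases "l \<le> n")
  case True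
  have "pochhammer (of_nat (Suc (n - l)) :: 'a) l = poly (falling_poly l) (of_nat n)"
    using True
  proof (induction l)
    case (Suc l)
    have "pochhammer (of_nat (Suc (n - Suc l)) :: 'a) (Suc l)
      = of_nat (n - l) * pochhammer (of_nat (Suc (n - l))) l"
      using Suc.prems by (simp only: Suc_diff_Suc less_eq_Suc_le pochhammer_rec of_nat_Suc add.commute)
    also have "\<dots> = (of_nat n - of_nat l) * poly (falling_poly l) (of_nat n)"
      using Suc by (simp only: of_nat_diff Suc_leD)
    finally show ?case
      by (simp add: falling_poly_def algebra_simps)
  qed (simp add: falling_poly_def)
  then show ?thesis
    using True by (simp add: coeff_monom_mult coeff_higher_pderiv)
next
  case False
  then have "poly (falling_poly l) (of_nat n :: 'a) = 0"
    by (auto simp: falling_poly_def poly_prod)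
  with False show ?thesis by (simp add: coeff_monom_mult)
qed

lemma degree_euler_pderiv: "degree (monom 1 l * (pderiv ^^ l) f) \<le> degree (f :: 'a::field poly)"
  by (rule degree_le) (simp add: coeff_euler_pderiv coeff_eq_0)

lemma coeff_mult_top:
  fixes f g :: "'a::comm_semiring_1 poly"
  assumes "degree f \<le> a" "degree g \<le> b"
  shows "coeff (f * g) (a + b) = coeff f a * coeff g b"
proof (cases "degree f = a \<and> degree g = b")
  case True
  then show ?thesis using coeff_mult_degree_sum[of f g] by simp
next
  case False
  then have "degree f + degree g < a + b" and "coeff f a = 0 \<or> coeff g b = 0"
    using assms by (auto intro: coeff_eq_0)
  then show ?thesis
    using degree_mult_le[of f g] by (auto simp: coeff_eq_0)
qed

lemma coeff_prod_top:
  fixes f :: "'b \<Rightarrow> 'a::comm_semiring_1 poly"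
  assumes "finite A" "\<And>i. i \<in> A \<Longrightarrow> degree (f i) \<le> d i"
  shows "coeff (\<Prod>i\<in>A. f i) (\<Sum>i\<in>A. d i) = (\<Prod>i\<in>A. coeff (f i) (d i))"
    and "degree (\<Prod>i\<in>A. f i) \<le> (\<Sum>i\<in>A. d i)"
proof -
  have "coeff (\<Prod>i\<in>A. f i) (\<Sum>i\<in>A. d i) = (\<Prod>i\<in>A. coeff (f i) (d i))
      \<and> degree (\<Prod>i\<in>A. f i) \<le> (\<Sum>i\<in>A. d i)"
    using assms
  proof (induction A rule: finite_induct)
    case (insert a A)
    then have IH: "coeff (\<Prod>i\<in>A. f i) (\<Sum>i\<in>A. d i) = (\<Prod>i\<in>A. coeff (f i) (d i))"
      "degree (\<Prod>i\<in>A. f i) \<le> (\<Sum>i\<in>A. d i)" "degree (f a) \<le> d a" by auto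
    have "degree (f a * (\<Prod>i\<in>A. f i)) \<le> d a + (\<Sum>i\<in>A. d i)"
      using IH degree_mult_le[of "f a" "\<Prod>i\<in>A. f i"] by linarith
    moreover have "coeff (f a * (\<Prod>i\<in>A. f i)) (d a + (\<Sum>i\<in>A. d i))
      = coeff (f a) (d a) * coeff (\<Prod>i\<in>A. f i) (\<Sum>i\<in>A. d i)"
      using IH by (intro coeff_mult_top) auto
    ultimately show ?case using insert IH by simp
  qed simp
  then show "coeff (\<Prod>i\<in>A. f i) (\<Sum>i\<in>A. d i) = (\<Prod>i\<in>A. coeff (f i) (d i))"
    and "degree (\<Prod>i\<in>A. f i) \<le> (\<Sum>i\<in>A. d i)" by auto
qed

definition wronskian :: "nat \<Rightarrow> (nat \<Rightarrow> 'a::field poly) \<Rightarrow> 'a poly" where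
  "wronskian n q = det (mat n n (\<lambda>(m, l). (pderiv ^^ l) (q m)))"

text \<open>Once column \<open>l\<close> is scaled by \<open>x ^ l\<close>, the coefficient at the
  sum of the degrees is a generalised Vandermonde determinant in the degrees, read in the field. A
  kernel vector would give a nonzero polynomial of degree below \<open>n\<close>, written in falling
  factorials, with \<open>n\<close> distinct roots.\<close>

lemma wronskian_nonzero_distinct_degrees:
  fixes q :: "nat \<Rightarrow> 'a::field poly"
  assumes nz: "\<And>m. m < n \<Longrightarrow> q m \<noteq> 0"
    and inj: "inj_on (\<lambda>m. of_nat (degree (q m)) :: 'a) {..<n}"
  shows "wronskian n q \<noteq> 0"
proof
  assume "wronskian n q = 0"
  let ?A = "mat n n (\<lambda>(m, l). monom 1 l * (pderiv ^^ l) (q m))"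
  let ?B = "mat n n (\<lambda>(m, l). poly (falling_poly l) (of_nat (degree (q m))) * lead_coeff (q m))"
  let ?D = "\<Sum>m = 0..<n. degree (q m)"
  have "det ?A = 0"
    using \<open>wronskian n q = 0\<close> det_scale_columns[of n "\<lambda>l. monom 1 l" "\<lambda>m l. (pderiv ^^ l) (q m)"]
    by (simp add: wronskian_def)
  moreover have "coeff (det ?A) ?D = det ?B"
  proof -
    have "coeff (signof \<pi> * (\<Prod>i = 0..<n. ?A $$ (i, \<pi> i))) ?D
      = signof \<pi> * (\<Prod>i = 0..<n. ?B $$ (i, \<pi> i))" if "\<pi> permutes {0..<n}" for \<pi>
    proof -
      have lt: "\<pi> i < n" if "i < n" for i
        using permutes_in_image[OF \<open>\<pi> permutes {0..<n}\<close>, of i] that by simp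
      have "coeff (\<Prod>i = 0..<n. ?A $$ (i, \<pi> i)) ?D = (\<Prod>i = 0..<n. coeff (?A $$ (i, \<pi> i)) (degree (q i)))"
        by (rule coeff_prod_top) (use lt degree_euler_pderiv in auto)
      also have "\<dots> = (\<Prod>i = 0..<n. ?B $$ (i, \<pi> i))"
        by (rule prod.cong) (use lt in \<open>auto simp: coeff_euler_pderiv\<close>)
      finally show ?thesis by (simp add: sign_def)
    qed
    then show ?thesis by (simp add: det_def coeff_sum)
  qed
  ultimately have "det ?B = 0" by simp
  moreover have "?B \<in> carrier_mat n n" by simp
  ultimately obtain v where v: "v \<in> carrier_vec n" "v \<noteq> 0\<^sub>v n" and eq: "?B *\<^sub>v v = 0\<^sub>v n"
    using det_0_iff_vec_prod_zero_field by blast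
  define f where "f = (\<Sum>l<n. smult (v $ l) (falling_poly l))"
  have root: "poly f (of_nat (degree (q m))) = 0" if "m < n" for m
  proof -
    have "(?B *\<^sub>v v) $ m = 0" using eq that by simp
    then have "(\<Sum>l<n. poly (falling_poly l) (of_nat (degree (q m))) * lead_coeff (q m) * v $ l) = 0"
      using that v by (simp add: scalar_prod_def atLeast0LessThan)
    also have "(\<Sum>l<n. poly (falling_poly l) (of_nat (degree (q m))) * lead_coeff (q m) * v $ l)
      = lead_coeff (q m) * poly f (of_nat (degree (q m)))"
      by (simp add: f_def poly_sum sum_distrib_left mult_ac)
    finally show ?thesis using nz that by simp
  qed
  have "f = 0"
  proof (rule ccontr)
    assume "f \<noteq> 0"
    have "n = card ((\<lambda>m. of_nat (degree (q m)) :: 'a) ` {..<n})"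
      using inj by (simp add: card_image)
    also have "\<dots> \<le> card {x. poly f x = 0}"
      by (rule card_mono) (use root \<open>f \<noteq> 0\<close> poly_roots_finite in auto)
    also have "\<dots> \<le> degree f"
      using \<open>f \<noteq> 0\<close> by (rule card_poly_roots_bound)
    finally have "n \<le> degree f" .
    moreover have "degree f < n" if "n > 0"
      unfolding f_def using that by (intro degree_sum_less) (auto simp: degree_falling_poly)
    ultimately show False
      using \<open>f \<noteq> 0\<close> by (cases "n = 0") (auto simp: f_def)
  qed
  then have "v $ l = 0" if "l < n" for l
    using falling_poly_combination_zero that unfolding f_def by blast
  then have "v = 0\<^sub>v n" using v by auto
  with v show False by simp
qed

lemma lin_indep_nonzero:
  fixes q :: "nat \<Rightarrow> 'a::field poly"
  assumes "lin_indep n q" "m < n"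
  shows "q m \<noteq> 0"
proof
  assume "q m = 0"
  then have "(\<Sum>i<n. smult (if i = m then 1 else 0) (q i)) = 0"
    by (intro sum.neutral) auto
  from assms(1)[unfolded lin_indep_def, rule_format, OF this assms(2)] have "(1::'a) = 0"
    by simp
  then show False by simp
qed

lemma lin_indep_subtract:
  assumes "lin_indep n q" "i < n" "j < n" "i \<noteq> j"
  shows "lin_indep n (q(i := q i - smult a (q j)))"
  unfolding lin_indep_def
proof (intro allI impI)
  fix c m
  assume eq: "(\<Sum>m<n. smult (c m) ((q(i := q i - smult a (q j))) m)) = 0" and m: "m < n"
  define c' where "c' = c(j := c j - c i * a)"
  have "(\<Sum>m<n. smult (c' m) (q m)) = (\<Sum>m<n. smult (c m) (q m)) - smult (c i * a) (q j)"
  proof -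
    have "(\<Sum>m<n. smult (c' m) (q m))
      = (\<Sum>m<n. smult (c m) (q m) - (if m = j then smult (c i * a) (q j) else 0))"
      by (rule sum.cong) (auto simp: c'_def smult_diff_left)
    then show ?thesis using assms by (simp add: sum_subtractf)
  qed
  also have "\<dots> = (\<Sum>m<n. smult (c m) ((q(i := q i - smult a (q j))) m))"
  proof -
    have "(\<Sum>m<n. smult (c m) ((q(i := q i - smult a (q j))) m))
      = (\<Sum>m<n. smult (c m) (q m) - (if m = i then smult (c i * a) (q j) else 0))"
      by (rule sum.cong) (auto simp: smult_diff_right)
    then show ?thesis using assms by (simp add: sum_subtractf)
  qed
  finally have "(\<Sum>m<n. smult (c' m) (q m)) = 0" using eq by simp
  with assms have c': "\<forall>m<n. c' m = 0" unfolding lin_indep_def by blast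
  then have "c i = 0" using assms by (auto simp: c'_def split: if_splits)
  with c' m show "c m = 0" by (auto simp: c'_def split: if_splits)
qed

text \<open>Elimination of leading terms: while two degrees agree, subtracting a multiple of one
  member from the other lowers the total degree and multiplies the Wronskian by a constant. At the
  end the degrees are distinct, and \<open>char\<close> keeps them distinct in the field.\<close>

lemma wronskian_nonzero:
  fixes q :: "nat \<Rightarrow> 'a::field poly"
  assumes "lin_indep n q" "\<And>m. m < n \<Longrightarrow> degree (q m) \<le> d"
    and char: "\<And>i. 0 < i \<Longrightarrow> i \<le> d \<Longrightarrow> of_nat i \<noteq> (0::'a)"
  shows "wronskian n q \<noteq> 0"
  using assms(1,2)
proof (induction "\<Sum>m<n. degree (q m)" arbitrary: q rule: less_induct)
  case less
  show ?case
  proof (cases "inj_on (\<lambda>m. degree (q m)) {..<n}")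
    case True
    have neq: "of_nat e \<noteq> (of_nat e' :: 'a)" if "e < e'" "e' \<le> d" for e e' :: nat
    proof -
      have "of_nat (e' - e) \<noteq> (0 :: 'a)" using that by (intro char) auto
      then show ?thesis using that by (simp add: of_nat_diff)
    qed
    have "inj_on (\<lambda>m. of_nat (degree (q m)) :: 'a) {..<n}"
    proof (rule inj_onI)
      fix m m' assume *: "m \<in> {..<n}" "m' \<in> {..<n}"
        "of_nat (degree (q m)) = (of_nat (degree (q m')) :: 'a)"
      then have "degree (q m) = degree (q m')"
        using neq less.prems(2) by (metis lessThan_iff linorder_neqE_nat)
      then show "m = m'" using True * by (auto dest: inj_onD)
    qed
    then show ?thesis
      using wronskian_nonzero_distinct_degrees lin_indep_nonzero less.prems(1) by blast
  next
    case False
    then obtain i j where ij: "i < n" "j < n" "i \<noteq> j" "degree (q i) = degree (q j)"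
      unfolding inj_on_def by auto
    define a where "a = lead_coeff (q i) / lead_coeff (q j)"
    define r where "r = q i - smult a (q j)"
    define q' where "q' = q(i := r)"
    have indep: "lin_indep n q'"
      unfolding q'_def r_def using lin_indep_subtract less.prems(1) ij by blast
    have "q j \<noteq> 0" "r \<noteq> 0"
      using lin_indep_nonzero[OF less.prems(1)] lin_indep_nonzero[OF indep, of i] ij
      by (auto simp: q'_def)
    moreover have "coeff r (degree (q i)) = 0"
      using ij \<open>q j \<noteq> 0\<close> by (simp add: r_def a_def)
    moreover have "degree r \<le> degree (q i)"
      unfolding r_def using ij by (intro degree_diff_le) auto
    ultimately have deg: "degree r < degree (q i)"
      by (metis leading_coeff_0_iff le_neq_implies_less)
    have "(\<Sum>m<n. degree (q' m)) < (\<Sum>m<n. degree (q m))"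
      by (rule sum_strict_mono_ex1) (use deg ij in \<open>auto simp: q'_def\<close>)
    moreover have "degree (q' m) \<le> d" if "m < n" for m
      using less.prems(2)[OF that] deg by (auto simp: q'_def)
    ultimately have "wronskian n q' \<noteq> 0"
      using less.hyps indep by blast
    moreover have "q' m = (\<Sum>l<n. smult (if l = m then 1 else if m = i \<and> l = j then - a else 0) (q l))"
      if "m < n" for m
    proof -
      have "(\<Sum>l<n. smult (if l = m then 1 else if m = i \<and> l = j then - a else 0) (q l))
        = (\<Sum>l<n. (if l = m then q m else 0) + (if l = j then (if m = i then - smult a (q j) else 0) else 0))"
        by (rule sum.cong) (use ij in auto)
      then show ?thesis using that ij by (simp add: sum.distrib q'_def r_def)
    qed
    ultimately show ?thesis
      unfolding wronskian_def
      using det_change_of_family[of n "\<lambda>l. pderiv ^^ l" q' _ q, OF linear_higher_pderiv] by auto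
  qed
qed

subsection \<open>Wronskians bordered by a column of values\<close>

text \<open>For \<open>l \<le> i\<close> this is the binomial coefficient (i choose l) times the
  \<open>(i - l)\<close>-th derivative of \<open>h\<close>, generated by Pascal's recursion; what
  matters later is that it is triangular with \<open>h\<close> on the diagonal.\<close>

primrec leibniz_coeff :: "'a::field poly \<Rightarrow> nat \<Rightarrow> nat \<Rightarrow> 'a poly" where
  "leibniz_coeff h 0 l = (if l = 0 then h else 0)"
| "leibniz_coeff h (Suc i) l =
    pderiv (leibniz_coeff h i l) + (if l = 0 then 0 else leibniz_coeff h i (l - 1))"

lemma leibniz_coeff_above: "i < l \<Longrightarrow> leibniz_coeff h i l = 0"
  by (induction i arbitrary: l) auto

lemma leibniz_coeff_diag: "leibniz_coeff h i i = h"
  by (induction i) (auto simp: leibniz_coeff_above)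

lemma higher_pderiv_mult:
  "(pderiv ^^ i) (h * q) = (\<Sum>l\<le>i. leibniz_coeff h i l * (pderiv ^^ l) q)"
proof (induction i)
  case (Suc i)
  have "(pderiv ^^ Suc i) (h * q)
    = (\<Sum>l\<le>i. pderiv (leibniz_coeff h i l) * (pderiv ^^ l) q)
      + (\<Sum>l\<le>i. leibniz_coeff h i l * (pderiv ^^ Suc l) q)"
    by (simp add: Suc higher_pderiv_sum[where n = 1, simplified] pderiv_mult sum.distrib algebra_simps)
  also have "(\<Sum>l\<le>i. pderiv (leibniz_coeff h i l) * (pderiv ^^ l) q)
    = (\<Sum>l\<le>Suc i. pderiv (leibniz_coeff h i l) * (pderiv ^^ l) q)"
    by (simp add: leibniz_coeff_above)
  also have "(\<Sum>l\<le>i. leibniz_coeff h i l * (pderiv ^^ Suc l) q)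
    = (\<Sum>l\<le>Suc i. (if l = 0 then 0 else leibniz_coeff h i (l - 1)) * (pderiv ^^ l) q)"
    by (subst sum.atMost_Suc_shift) simp
  finally show ?case
    by (simp only: leibniz_coeff.simps distrib_right sum.distrib)
qed simp

text \<open>By the Leibniz rule the new matrix is the old one times an upper triangular matrix with
  diagonal \<open>h\<close>.\<close>

lemma wronskian_mult:
  fixes h :: "'a::field poly"
  shows "wronskian n (\<lambda>m. h * q m) = h ^ n * wronskian n q"
proof -
  let ?L = "mat n n (\<lambda>(l, i). leibniz_coeff h i l)"
  let ?Q = "mat n n (\<lambda>(m, l). (pderiv ^^ l) (q m))"
  have "mat n n (\<lambda>(m, l). (pderiv ^^ l) (h * q m)) = ?Q * ?L"
  proof (rule eq_matI)
    fix m i assume *: "m < dim_row (?Q * ?L)" "i < dim_col (?Q * ?L)"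
    then have "(\<Sum>l\<le>i. leibniz_coeff h i l * (pderiv ^^ l) (q m))
      = (\<Sum>l<n. leibniz_coeff h i l * (pderiv ^^ l) (q m))"
      by (intro sum.mono_neutral_left) (auto simp: leibniz_coeff_above)
    with * show "mat n n (\<lambda>(m, l). (pderiv ^^ l) (h * q m)) $$ (m, i) = (?Q * ?L) $$ (m, i)"
      by (simp add: higher_pderiv_mult scalar_prod_def atLeast0LessThan mult.commute)
  qed auto
  moreover have "det ?L = h ^ n"
  proof -
    have "upper_triangular ?L"
      by (auto simp: upper_triangular_def leibniz_coeff_above)
    then have "det ?L = prod_list (diag_mat ?L)"
      by (rule det_upper_triangular[of _ n]) simp
    then show ?thesis
      by (simp add: prod_list_diag_prod leibniz_coeff_diag)
  qed
  ultimately show ?thesis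
    by (simp add: wronskian_def det_mult[of _ n])
qed

section \<open>Bordered determinants: change of family, order and degree\<close>

definition bordered :: "'a::field \<Rightarrow> nat \<Rightarrow> (nat \<Rightarrow> 'a poly) \<Rightarrow> 'a poly" where
  "bordered x n F = det (mat n n (\<lambda>(m, l).
    (case l of 0 \<Rightarrow> \<lambda>f. [:poly f x:] | Suc i \<Rightarrow> pderiv ^^ i) (F m)))"

lemma bordered_change_of_family:
  fixes F G :: "nat \<Rightarrow> 'a::field poly"
  assumes "lin_indep n G"
    and "\<And>m. m < n \<Longrightarrow> G m = (\<Sum>j<n. smult (C m j) (F j))"
  obtains a where "a \<noteq> 0" "bordered x n G = smult a (bordered x n F)"
proof
  show "det (mat n n (\<lambda>(m, j). C m j)) \<noteq> 0"
    by (rule det_coeffs_nonzero[OF assms])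
  show "bordered x n G = smult (det (mat n n (\<lambda>(m, j). C m j))) (bordered x n F)"
    unfolding bordered_def
    by (rule det_change_of_family)
      (auto split: nat.split simp: linear_higher_pderiv linear_poly_eval assms(2))
qed

text \<open>Column \<open>l \<ge> 1\<close> holds derivatives of order \<open>l - 1\<close> and gets
  the matching power. Truncated subtraction makes the exponent 0 at \<open>l = 0\<close>, so the
  column of values stays unscaled.\<close>

lemma bordered_scaled:
  fixes r :: "'a::field poly"
  shows "r ^ (\<Sum>l<n. l - 1) * bordered x n F = det (mat n n (\<lambda>(m, l).
    r ^ (l - 1) * (case l of 0 \<Rightarrow> \<lambda>f. [:poly f x:] | Suc i \<Rightarrow> pderiv ^^ i) (F m)))"
  unfolding bordered_def power_sum by (rule det_scale_columns[symmetric])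

lemma linear_power_dvd_pderiv:
  fixes f :: "'a::field poly"
  assumes "[:- c, 1:] ^ n dvd f"
  shows "[:- c, 1:] ^ n dvd [:- c, 1:] ^ i * (pderiv ^^ i) f"
proof -
  have step: "[:- c, 1:] ^ (e - 1) dvd pderiv g" if "[:- c, 1:] ^ e dvd g" for g e
  proof (cases e)
    case (Suc e')
    from that obtain g' where "g = [:- c, 1:] ^ Suc e' * g'" unfolding Suc by blast
    moreover have "pderiv [:- c, 1:] = 1" by (simp add: pderiv_pCons)
    ultimately have "pderiv g = [:- c, 1:] ^ e' * ([:- c, 1:] * pderiv g' + smult (of_nat (Suc e')) g')"
      by (simp only: pderiv_mult pderiv_power_Suc) (simp add: ring_distribs mult_ac smult_add_left)
    then show ?thesis unfolding Suc by (metis dvd_triv_left diff_Suc_1)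
  qed simp
  have "[:- c, 1:] ^ (n - i) dvd (pderiv ^^ i) f"
  proof (induction i)
    case (Suc i)
    then show ?case using step[OF Suc] by simp
  qed (use assms in simp)
  \<comment> \<open>The exponent \<open>i + (n - i)\<close> is at least \<open>n\<close> even for
    \<open>i > n\<close>, where \<open>n - i\<close> is 0.\<close>
  then have "[:- c, 1:] ^ (i + (n - i)) dvd [:- c, 1:] ^ i * (pderiv ^^ i) f"
    unfolding power_add by (rule mult_dvd_mono[OF dvd_refl])
  then show ?thesis
    by (rule power_le_dvd) simp
qed

lemma sum_remove_ge:
  fixes w :: "nat \<Rightarrow> nat"
  assumes "i < n" "w i \<le> b"
  shows "(\<Sum>m<n. w m) - b \<le> (\<Sum>m\<in>{..<n} - {i}. w m)"
  using sum.remove[of "{..<n}" i w] assms by simp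

text \<open>In each term of the determinant exactly one row contributes a constant from the column
  of values. That row loses its order, at most \<open>b\<close>; every other row keeps its own after
  scaling.\<close>

lemma bordered_order:
  fixes F :: "nat \<Rightarrow> 'a::field poly"
  assumes "\<And>m. m < n \<Longrightarrow> [:- c, 1:] ^ w m dvd F m" and "\<And>m. m < n \<Longrightarrow> w m \<le> b" and "0 < n"
  shows "[:- c, 1:] ^ ((\<Sum>m<n. w m) - b) dvd [:- c, 1:] ^ (\<Sum>l<n. l - 1) * bordered x n F"
proof -
  let ?f = "\<lambda>m l. [:- c, 1:] ^ (l - 1) *
    (case l of 0 \<Rightarrow> \<lambda>f. [:poly f x:] | Suc i \<Rightarrow> pderiv ^^ i) (F m)"
  have "[:- c, 1:] ^ ((\<Sum>m<n. w m) - b) dvd signof \<pi> * (\<Prod>i = 0..<n. mat n n (\<lambda>(m, l). ?f m l) $$ (i, \<pi> i))"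
    if \<pi>: "\<pi> permutes {0..<n}" for \<pi>
  proof -
    have lt: "\<pi> i < n" if "i < n" for i
      using permutes_in_image[OF \<pi>, of i] that by simp
    obtain i0 where i0: "i0 < n" "\<pi> i0 = 0"
      using \<pi> \<open>0 < n\<close> by (metis permutes_in_image permutes_surj surjD atLeastLessThan_iff zero_le)
    have ne: "\<pi> i \<noteq> 0" if "i \<noteq> i0" for i
      using i0 that permutes_inj[OF \<pi>] by (metis injD)
    have "[:- c, 1:] ^ ((\<Sum>m<n. w m) - b) dvd [:- c, 1:] ^ (\<Sum>i\<in>{..<n} - {i0}. w i)"
      by (rule le_imp_power_dvd, rule sum_remove_ge) (use i0 assms in auto)
    also have "\<dots> dvd (\<Prod>i\<in>{..<n} - {i0}. ?f i (\<pi> i))"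
      unfolding power_sum
    proof (rule prod_dvd_prod)
      fix i assume i: "i \<in> {..<n} - {i0}"
      then obtain l where "\<pi> i = Suc l" using ne by (metis DiffE insertI1 not0_implies_Suc)
      then show "[:- c, 1:] ^ w i dvd ?f i (\<pi> i)"
        using linear_power_dvd_pderiv[OF assms(1)] i by simp
    qed
    also have "\<dots> dvd (\<Prod>i<n. ?f i (\<pi> i))"
      by (rule prod_dvd_prod_subset) auto
    also have "(\<Prod>i<n. ?f i (\<pi> i)) = (\<Prod>i = 0..<n. mat n n (\<lambda>(m, l). ?f m l) $$ (i, \<pi> i))"
      unfolding atLeast0LessThan by (rule prod.cong) (use lt in auto)
    finally show ?thesis by (rule dvd_mult)
  qed
  then show ?thesis
    unfolding bordered_scaled det_def by (auto intro: dvd_sum)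
qed

text \<open>The counterpart at infinity: the row that contributes the constant saves its whole
  degree bound, at least \<open>b\<close>.\<close>

lemma bordered_degree:
  fixes F :: "nat \<Rightarrow> 'a::field poly"
  assumes "\<And>m. m < n \<Longrightarrow> degree (F m) \<le> d m" and "\<And>m. m < n \<Longrightarrow> b \<le> d m" and "0 < n"
  shows "degree ([:0, 1:] ^ (\<Sum>l<n. l - 1) * bordered x n F) + b \<le> (\<Sum>m<n. d m)"
proof -
  let ?f = "\<lambda>m l. [:0, 1:] ^ (l - 1) *
    (case l of 0 \<Rightarrow> \<lambda>f. [:poly f x:] | Suc i \<Rightarrow> pderiv ^^ i) (F m)"
  have "b \<le> (\<Sum>m<n. d m)"
    using assms(2)[of 0] \<open>0 < n\<close> member_le_sum[of 0 "{..<n}" d] by fastforce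
  have "degree (signof \<pi> * (\<Prod>i = 0..<n. mat n n (\<lambda>(m, l). ?f m l) $$ (i, \<pi> i))) \<le> (\<Sum>m<n. d m) - b"
    if \<pi>: "\<pi> permutes {0..<n}" for \<pi>
  proof -
    have lt: "\<pi> i < n" if "i < n" for i
      using permutes_in_image[OF \<pi>, of i] that by simp
    obtain i0 where i0: "i0 < n" "\<pi> i0 = 0"
      using \<pi> \<open>0 < n\<close> by (metis permutes_in_image permutes_surj surjD atLeastLessThan_iff zero_le)
    have ne: "\<pi> i \<noteq> 0" if "i \<noteq> i0" for i
      using i0 that permutes_inj[OF \<pi>] by (metis injD)
    have "degree (\<Prod>i<n. ?f i (\<pi> i)) \<le> (\<Sum>i<n. if i = i0 then 0 else d i)"
    proof (rule coeff_prod_top(2))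
      fix i assume i: "i \<in> {..<n}"
      show "degree (?f i (\<pi> i)) \<le> (if i = i0 then 0 else d i)"
      proof (cases "i = i0")
        case False
        then obtain l where "\<pi> i = Suc l" using ne by (metis not0_implies_Suc)
        then show ?thesis
          using degree_euler_pderiv[of l "F i"] assms(1)[of i] i False
          by (simp add: monom_altdef)
      qed (use i0 in simp)
    qed simp
    also have "\<dots> = (\<Sum>i\<in>{..<n} - {i0}. d i)"
      by (rule sum.mono_neutral_cong_right) auto
    also have "\<dots> \<le> (\<Sum>m<n. d m) - b"
      using sum.remove[of "{..<n}" i0 d] assms(2)[OF i0(1)] i0 by simp
    also have "(\<Prod>i<n. ?f i (\<pi> i)) = (\<Prod>i = 0..<n. mat n n (\<lambda>(m, l). ?f m l) $$ (i, \<pi> i))"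
      unfolding atLeast0LessThan by (rule prod.cong) (use lt in auto)
    finally show ?thesis by (simp add: sign_def)
  qed
  then have "degree ([:0, 1:] ^ (\<Sum>l<n. l - 1) * bordered x n F) \<le> (\<Sum>m<n. d m) - b"
    unfolding bordered_scaled det_def by (auto intro!: degree_sum_le finite_permutations)
  with \<open>b \<le> (\<Sum>m<n. d m)\<close> show ?thesis by simp
qed

text \<open>Row operations with \<open>F 0\<close> leave the rows \<open>h * q m\<close>, which
  vanish at \<open>x\<close>. The first column then has a single possibly nonzero entry, and
  expanding along it leaves the Wronskian of the \<open>h * q m\<close>.\<close>

lemma bordered_factor:
  fixes F :: "nat \<Rightarrow> 'a::field poly"
  assumes indep: "lin_indep (Suc n) F"
    and q: "\<And>m. m < n \<Longrightarrow> F (Suc m) = smult (e m) (F 0) + h * q m"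
    and "poly h x = 0"
  obtains a where "a \<noteq> 0" "bordered x (Suc n) F = smult (a * poly (F 0) x) (h ^ n * wronskian n q)"
proof -
  define G where "G m = (case m of 0 \<Rightarrow> F 0 | Suc m' \<Rightarrow> h * q m')" for m
  define C where "C m j = (if j = m then 1 else if j = 0 then e (m - 1) else 0)" for m j
  have "F m = (\<Sum>j<Suc n. smult (C m j) (G j))" if "m < Suc n" for m
  proof (cases m)
    case 0
    then show ?thesis by (simp add: C_def G_def sum.lessThan_Suc_shift del: sum.lessThan_Suc)
  next
    case (Suc m')
    then have "(\<Sum>j<n. smult (C m (Suc j)) (G (Suc j))) = (\<Sum>j<n. if j = m' then h * q m' else 0)"
      by (intro sum.cong) (auto simp: C_def G_def)
    then show ?thesis
      using that Suc q by (simp add: C_def G_def sum.lessThan_Suc_shift del: sum.lessThan_Suc)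
  qed
  then obtain a where a: "a \<noteq> 0" "bordered x (Suc n) F = smult a (bordered x (Suc n) G)"
    using bordered_change_of_family[OF indep] by metis
  let ?B = "mat (Suc n) (Suc n) (\<lambda>(m, l).
    (case l of 0 \<Rightarrow> \<lambda>f. [:poly f x:] | Suc i \<Rightarrow> pderiv ^^ i) (G m))"
  have "det ?B = (\<Sum>i<Suc n. ?B $$ (i, 0) * cofactor ?B i 0)"
    by (rule laplace_expansion_column) auto
  also have "\<dots> = [:poly (F 0) x:] * cofactor ?B 0 0"
    by (subst sum.lessThan_Suc_shift) (simp add: G_def \<open>poly h x = 0\<close>)
  also have "cofactor ?B 0 0 = wronskian n (\<lambda>m. h * q m)"
    unfolding cofactor_def wronskian_def mat_delete_def
    by (auto simp: G_def intro!: arg_cong[where f = det] eq_matI)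
  finally have "bordered x (Suc n) G = smult (poly (F 0) x) (h ^ n * wronskian n q)"
    by (simp add: bordered_def wronskian_mult)
  with a that show ?thesis by simp
qed

subsection \<open>Families of products of powers\<close>

lemma linear_power_dvd_cancel:
  fixes f g :: "'a::field poly"
  assumes "[:- x, 1:] ^ e dvd f * g" "poly f x \<noteq> 0"
  shows "[:- x, 1:] ^ e dvd g"
proof (cases "g = 0")
  case False
  then have "f * g \<noteq> 0" using assms by auto
  then have "order x (f * g) = order x g"
    using assms(2) by (simp add: order_mult order_0I)
  then show ?thesis
    using assms(1) \<open>f * g \<noteq> 0\<close> False by (simp add: order_divides)
qed simp

lemma prod_linear_powers_dvd:
  fixes f :: "'a::field poly"
  assumes "finite S" "\<And>x. x \<in> S \<Longrightarrow> [:- x, 1:] ^ e x dvd f"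
  shows "(\<Prod>x\<in>S. [:- x, 1:] ^ e x) dvd f"
  using assms
proof (induction S rule: finite_induct)
  case (insert x S)
  then obtain g where g: "f = (\<Prod>x\<in>S. [:- x, 1:] ^ e x) * g" by auto
  have "poly (\<Prod>x\<in>S. [:- x, 1:] ^ e x) x \<noteq> 0"
    using insert by (auto simp: poly_prod)
  then have "[:- x, 1:] ^ e x dvd g"
    using insert.prems[of x] linear_power_dvd_cancel unfolding g by blast
  then show ?case
    using insert g by (simp add: mult.commute mult_dvd_mono)
qed simp

lemma sum_order_le_degree:
  fixes f :: "'a::field poly"
  assumes "finite S" "f \<noteq> 0"
  shows "(\<Sum>x\<in>S. order x f) \<le> degree f"
proof -
  have "(\<Prod>x\<in>S. [:- x, 1:] ^ order x f) dvd f"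
    by (rule prod_linear_powers_dvd[OF assms(1)]) (rule order_1)
  then have "degree (\<Prod>x\<in>S. [:- x, 1:] ^ order x f) \<le> degree f"
    using assms(2) by (rule dvd_imp_degree_le)
  moreover have "degree (\<Prod>x\<in>S. [:- x, 1:] ^ order x f) = (\<Sum>x\<in>S. order x f)"
    by (subst degree_prod_eq_sum_degree) (auto simp: degree_linear_power)
  ultimately show ?thesis by simp
qed

section \<open>Linear independence of the products of powers\<close>

lemma pcompose_power_left: "pcompose (f ^ n) g = pcompose f g ^ n"
  for f :: "'a::comm_semiring_1 poly"
  by (induction n) (auto simp: pcompose_mult one_pCons pcompose_pCons)

text \<open>\<open>\<alpha>\<close> is a simple root, because the derivative there is
  \<open>of_nat k * \<alpha> ^ (k - 1)\<close>.\<close>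

lemma power_shift_squarefree:
  fixes \<alpha> :: "'a::field"
  assumes "of_nat k \<noteq> (0::'a)" "\<alpha> \<noteq> 0"
  obtains E where "monom 1 k - [:\<alpha> ^ k:] = [:- \<alpha>, 1:] * E" "poly E \<alpha> \<noteq> 0"
proof -
  have "poly (monom 1 k - [:\<alpha> ^ k:]) \<alpha> = 0" by (simp add: poly_monom)
  then obtain E where E: "monom 1 k - [:\<alpha> ^ k:] = [:- \<alpha>, 1:] * E"
    unfolding poly_eq_0_iff_dvd by blast
  have "pderiv (monom 1 k - [:\<alpha> ^ k:]) = monom (of_nat k) (k - 1)"
    by (simp add: pderiv_diff pderiv_monom pderiv_pCons)
  moreover have "poly (pderiv ([:- \<alpha>, 1:] * E)) \<alpha> = poly E \<alpha>"
  proof -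
    have "pderiv [:- \<alpha>, 1:] = 1" by (simp add: pderiv_pCons)
    then show ?thesis by (simp only: pderiv_mult poly_add poly_mult) simp
  qed
  ultimately have "poly E \<alpha> = of_nat k * \<alpha> ^ (k - 1)"
    unfolding E by (metis poly_monom)
  then show ?thesis using that E assms by simp
qed

text \<open>Since \<open>\<alpha>\<close> is a simple root of \<open>x ^ k - \<alpha> ^ k\<close>, a
  nonzero \<open>S\<close> composed with \<open>x ^ k\<close> vanishes at \<open>\<alpha>\<close>
  exactly as often as \<open>S\<close> does at \<open>\<alpha> ^ k\<close>, hence at most
  \<open>degree S\<close> times.\<close>

lemma pcompose_monom_order_bound:
  fixes S :: "'a::field poly"
  assumes "of_nat k \<noteq> (0::'a)" "\<alpha> \<noteq> 0" "degree S < k"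
    and dvd: "[:- \<alpha>, 1:] ^ k dvd pcompose S (monom 1 k)"
  shows "S = 0"
proof (rule ccontr)
  assume "S \<noteq> 0"
  define m where "m = order (\<alpha> ^ k) S"
  have "m < k" using order_degree[OF \<open>S \<noteq> 0\<close>, of "\<alpha> ^ k"] assms(3) m_def by simp
  obtain T where T: "S = [:- (\<alpha> ^ k), 1:] ^ m * T" "\<not> [:- (\<alpha> ^ k), 1:] dvd T"
    using order_decomp[OF \<open>S \<noteq> 0\<close>, of "\<alpha> ^ k"] m_def by blast
  obtain E where E: "monom 1 k - [:\<alpha> ^ k:] = [:- \<alpha>, 1:] * E" "poly E \<alpha> \<noteq> 0"
    using power_shift_squarefree assms by blast
  have "pcompose [:- (\<alpha> ^ k), 1:] (monom 1 k) = monom 1 k - [:\<alpha> ^ k:]"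
    by (simp add: pcompose_pCons)
  then have "pcompose S (monom 1 k) = ([:- \<alpha>, 1:] * E) ^ m * pcompose T (monom 1 k)"
    by (simp only: T(1) pcompose_mult pcompose_power_left E(1))
  also have "\<dots> = [:- \<alpha>, 1:] ^ m * (E ^ m * pcompose T (monom 1 k))"
    by (simp only: power_mult_distrib mult.assoc)
  finally have "[:- \<alpha>, 1:] ^ m * [:- \<alpha>, 1:] ^ (k - m)
      dvd [:- \<alpha>, 1:] ^ m * (E ^ m * pcompose T (monom 1 k))"
    using dvd \<open>m < k\<close> by (simp flip: power_add)
  then have "[:- \<alpha>, 1:] ^ (k - m) dvd E ^ m * pcompose T (monom 1 k)"
    by (subst (asm) dvd_mult_cancel_left) auto
  moreover have "[:- \<alpha>, 1:] dvd [:- \<alpha>, 1:] ^ (k - m)"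
    using \<open>m < k\<close> by (intro dvd_power) simp
  ultimately have "poly (E ^ m * pcompose T (monom 1 k)) \<alpha> = 0"
    using dvd_trans poly_eq_0_iff_dvd by blast
  then have "poly T (\<alpha> ^ k) = 0"
    using E(2) by (simp add: poly_pcompose poly_monom)
  with T(2) show False by (simp add: poly_eq_0_iff_dvd)
qed

text \<open>
  The top coefficient is divisible by \<open>(x - \<alpha>) ^ k\<close>, although it is a polynomial of degree below \<open>k\<close> in \<open>x ^ k\<close>.
\<close>

lemma homogeneous_relation_trivial:
  fixes S :: "nat \<Rightarrow> 'a::field poly"
  assumes k: "of_nat k \<noteq> (0::'a)" and "\<alpha> \<noteq> 0" and deg: "\<And>j. degree (S j) < k"
    and Q: "[:- \<alpha>, 1:] ^ k dvd Q" "Q \<noteq> 0" and P: "poly P \<alpha> \<noteq> 0"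
  shows "(\<Sum>j\<le>t. pcompose (S j) (monom 1 k) * P ^ j * Q ^ (t - j)) = 0 \<Longrightarrow> j \<le> t \<Longrightarrow> S j = 0"
proof (induction t arbitrary: j)
  case 0
  then have "pcompose (S 0) (monom 1 k) = 0" by simp
  then have "S 0 = 0"
    by (rule pcompose_eq_0) (use k in \<open>auto simp: degree_monom_eq intro!: gr0I\<close>)
  with 0 show ?case by simp
next
  case (Suc t)
  let ?R = "\<lambda>j. pcompose (S j) (monom 1 k)"
  have "(\<Sum>j\<le>t. ?R j * P ^ j * Q ^ (Suc t - j)) = Q * (\<Sum>j\<le>t. ?R j * P ^ j * Q ^ (t - j))"
    unfolding sum_distrib_left by (rule sum.cong) (auto simp: Suc_diff_le mult_ac)
  with Suc.prems(1) have eq: "Q * (\<Sum>j\<le>t. ?R j * P ^ j * Q ^ (t - j)) + P ^ Suc t * ?R (Suc t) = 0"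
    by (simp add: mult.commute)
  then have "Q dvd P ^ Suc t * ?R (Suc t)"
    unfolding add_eq_0_iff by simp
  with Q have "[:- \<alpha>, 1:] ^ k dvd P ^ Suc t * ?R (Suc t)"
    using dvd_trans by blast
  then have "[:- \<alpha>, 1:] ^ k dvd ?R (Suc t)"
    by (rule linear_power_dvd_cancel) (use P in simp)
  then have "S (Suc t) = 0"
    using pcompose_monom_order_bound k \<open>\<alpha> \<noteq> 0\<close> deg by blast
  with eq Q have "(\<Sum>j\<le>t. ?R j * P ^ j * Q ^ (t - j)) = 0" by simp
  with Suc \<open>S (Suc t) = 0\<close> show ?case by (cases "j = Suc t") auto
qed

lemma sum_div_mod:
  fixes f :: "nat \<Rightarrow> nat \<Rightarrow> 'b::comm_monoid_add"
  assumes "0 < b"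
  shows "(\<Sum>m<a * b. f (m div b) (m mod b)) = (\<Sum>i<a. \<Sum>j<b. f i j)"
proof -
  have "(\<Sum>m\<in>{i * b..<i * b + b}. f (m div b) (m mod b)) = (\<Sum>j<b. f i j)" for i
  proof -
    have "(\<Sum>m\<in>{i * b..<i * b + b}. f (m div b) (m mod b))
      = (\<Sum>j<b. f ((j + i * b) div b) ((j + i * b) mod b))"
      using sum.shift_bounds_nat_ivl[of "\<lambda>m. f (m div b) (m mod b)" 0 "i * b" b]
      by (simp only: atLeast0LessThan add_0 add.commute[of b])
    then show ?thesis by simp
  qed
  then show ?thesis
    by (simp flip: sum.nat_group)
qed

text \<open>
  The pair of exponents \<open>(i, j)\<close> is encoded as \<open>m = i * (s + 1) + j\<close>.
\<close>

definition power_family :: "nat \<Rightarrow> nat \<Rightarrow> 'a::field \<Rightarrow> 'a poly \<Rightarrow> 'a poly \<Rightarrow> nat \<Rightarrow> 'a poly" where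
  "power_family k s \<gamma> P Q m =
    (monom 1 k - [:\<gamma>:]) ^ (m div Suc s) * P ^ (m mod Suc s) * Q ^ (s - m mod Suc s)"

text \<open>Substituting \<open>x + \<gamma>\<close> for \<open>x\<close> turns the shifted powers
  into monomials.\<close>

lemma shifted_powers_independent:
  fixes c :: "nat \<Rightarrow> 'a::field"
  assumes "(\<Sum>i\<le>s. smult (c i) ([:- \<gamma>, 1:] ^ i)) = 0" "i \<le> s"
  shows "c i = 0"
proof -
  have "pcompose [:- \<gamma>, 1:] [:\<gamma>, 1:] = monom 1 1"
    by (simp add: pcompose_pCons monom_altdef)
  then have "(\<Sum>i\<le>s. monom (c i) i) = pcompose (\<Sum>i\<le>s. smult (c i) ([:- \<gamma>, 1:] ^ i)) [:\<gamma>, 1:]"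
    by (simp add: pcompose_sum pcompose_smult pcompose_power_left monom_power smult_monom)
  then have "coeff (\<Sum>i\<le>s. monom (c i) i) i = 0" using assms by simp
  then show ?thesis using assms(2) by (simp add: coeff_sum)
qed

text \<open>Collecting the terms with the same \<open>j\<close> turns a relation into a form of
  degree \<open>s\<close> in \<open>P\<close> and \<open>Q\<close> whose coefficients are
  polynomials of degree at most \<open>s < k\<close> in \<open>x ^ k\<close>. These all vanish, and
  then so do their coefficients in powers of \<open>x ^ k - \<gamma>\<close>.\<close>

lemma lin_indep_power_family:
  fixes P Q :: "'a::field poly"
  assumes k: "of_nat k \<noteq> (0::'a)" and "s < k" and "\<alpha> \<noteq> 0"
    and Q: "[:- \<alpha>, 1:] ^ k dvd Q" "Q \<noteq> 0" and P: "poly P \<alpha> \<noteq> 0"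
  shows "lin_indep (Suc s * Suc s) (power_family k s \<gamma> P Q)"
  unfolding lin_indep_def
proof (intro allI impI)
  fix c m
  assume eq: "(\<Sum>m<Suc s * Suc s. smult (c m) (power_family k s \<gamma> P Q m)) = 0"
    and m: "m < Suc s * Suc s"
  define c' where "c' i j = c (i * Suc s + j)" for i j
  define S where "S j = (if j \<le> s then \<Sum>i\<le>s. smult (c' i j) ([:- \<gamma>, 1:] ^ i) else 0)" for j
  have c': "c' (m div Suc s) (m mod Suc s) = c m" for m
    unfolding c'_def by (simp only: div_mult_mod_eq)
  have "pcompose [:- \<gamma>, 1:] (monom 1 k) = monom 1 k - [:\<gamma>:]"
    by (simp add: pcompose_pCons)
  then have R: "pcompose (S j) (monom 1 k) = (\<Sum>i\<le>s. smult (c' i j) ((monom 1 k - [:\<gamma>:]) ^ i))"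
    if "j \<le> s" for j
    using that by (simp add: S_def pcompose_sum pcompose_smult pcompose_power_left)
  have "(\<Sum>m<Suc s * Suc s. smult (c m) (power_family k s \<gamma> P Q m))
    = (\<Sum>m<Suc s * Suc s. smult (c' (m div Suc s) (m mod Suc s)) ((monom 1 k - [:\<gamma>:]) ^ (m div Suc s) *
      P ^ (m mod Suc s) * Q ^ (s - m mod Suc s)))"
    by (simp only: c' power_family_def)
  also have "\<dots> = (\<Sum>i<Suc s. \<Sum>j<Suc s. smult (c' i j) ((monom 1 k - [:\<gamma>:]) ^ i * P ^ j * Q ^ (s - j)))"
    by (rule sum_div_mod[of "Suc s" "\<lambda>i j. smult (c' i j) ((monom 1 k - [:\<gamma>:]) ^ i * P ^ j * Q ^ (s - j))"]) simp
  also have "\<dots> = (\<Sum>j\<le>s. \<Sum>i\<le>s. smult (c' i j) ((monom 1 k - [:\<gamma>:]) ^ i * P ^ j * Q ^ (s - j)))"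
    unfolding lessThan_Suc_atMost by (rule sum.swap)
  also have "\<dots> = (\<Sum>j\<le>s. pcompose (S j) (monom 1 k) * P ^ j * Q ^ (s - j))"
    by (intro sum.cong refl) (simp add: R sum_distrib_right)
  finally have sum0: "(\<Sum>j\<le>s. pcompose (S j) (monom 1 k) * P ^ j * Q ^ (s - j)) = 0"
    using eq by simp
  have "degree (S j) < k" for j
  proof -
    have "degree (smult (c' i j) ([:- \<gamma>, 1:] ^ i)) \<le> s" if "i \<le> s" for i
      using degree_smult_le[of "c' i j" "[:- \<gamma>, 1:] ^ i"] that by (simp add: degree_linear_power)
    then have "degree (\<Sum>i\<le>s. smult (c' i j) ([:- \<gamma>, 1:] ^ i)) \<le> s"
      by (intro degree_sum_le) auto
    then have "degree (S j) \<le> s" by (simp only: S_def split: if_split) simp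
    then show ?thesis using \<open>s < k\<close> by simp
  qed
  then have S0: "S j = 0" if "j \<le> s" for j
    using homogeneous_relation_trivial[OF k \<open>\<alpha> \<noteq> 0\<close> _ Q P sum0 that] by blast
  have "c' i j = 0" if "i \<le> s" "j \<le> s" for i j
  proof -
    have "(\<Sum>i\<le>s. smult (c' i j) ([:- \<gamma>, 1:] ^ i)) = 0"
      using S0[OF that(2)] that(2) by (simp only: S_def if_True)
    then show ?thesis
      using shifted_powers_independent[where c = "\<lambda>i. c' i j"] that(1) by blast
  qed
  moreover have "m div Suc s \<le> s" using less_mult_imp_div_less[OF m] by simp
  moreover have "m mod Suc s \<le> s" using mod_less_divisor[of "Suc s" m] by simp
  ultimately have "c' (m div Suc s) (m mod Suc s) = 0" by blast
  then show "c m = 0" by (simp only: c')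
qed

section \<open>Adapted bases of the same space\<close>

lemma homogeneous_span_step:
  fixes P Q :: "'a::field poly"
  shows "\<exists>v'. (smult a P + smult b Q) * (\<Sum>j\<le>t. smult (v j) (P ^ j * Q ^ (t - j)))
    = (\<Sum>j\<le>Suc t. smult (v' j) (P ^ j * Q ^ (Suc t - j)))"
proof (intro exI)
  let ?g = "\<lambda>j. P ^ j * Q ^ (Suc t - j)"
  have "(smult a P + smult b Q) * (\<Sum>j\<le>t. smult (v j) (P ^ j * Q ^ (t - j)))
    = (\<Sum>j\<le>t. smult (a * v j) (?g (Suc j))) + (\<Sum>j\<le>t. smult (b * v j) (?g j))"
    unfolding distrib_right sum_distrib_left sum.distrib[symmetric]
    by (rule sum.cong) (auto simp: Suc_diff_le mult_ac)
  also have "(\<Sum>j\<le>t. smult (a * v j) (?g (Suc j)))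
    = (\<Sum>j\<le>Suc t. smult (if j = 0 then 0 else a * v (j - 1)) (?g j))"
    by (subst sum.atMost_Suc_shift) simp
  also have "(\<Sum>j\<le>t. smult (b * v j) (?g j))
    = (\<Sum>j\<le>Suc t. smult (if j = Suc t then 0 else b * v j) (?g j))"
    by simp
  finally show "(smult a P + smult b Q) * (\<Sum>j\<le>t. smult (v j) (P ^ j * Q ^ (t - j)))
    = (\<Sum>j\<le>Suc t. smult ((if j = 0 then 0 else a * v (j - 1)) + (if j = Suc t then 0 else b * v j)) (?g j))"
    by (simp only: smult_add_left sum.distrib)
qed

lemma homogeneous_span:
  fixes P Q :: "'a::field poly"
  shows "\<exists>v. (smult a P + smult b Q) ^ i * (smult a' P + smult b' Q) ^ i'
    = (\<Sum>j\<le>i + i'. smult (v j) (P ^ j * Q ^ (i + i' - j)))"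
proof (induction i)
  case 0
  show ?case
  proof (induction i')
    case 0
    show ?case by (intro exI[of _ "\<lambda>_. 1"]) simp
  next
    case (Suc i')
    then show ?case
      using homogeneous_span_step[of a' P b' Q _ i'] by (auto simp: mult_ac)
  qed
next
  case (Suc i)
  then show ?case
    using homogeneous_span_step[of a P b Q _ "i + i'"] by (auto simp: mult.assoc)
qed

text \<open>Shifting \<open>x ^ k\<close> by a constant and replacing \<open>P\<close>,
  \<open>Q\<close> by linear combinations both stay inside one space of bidegree
  \<open>(s, s)\<close>. This permits a separate basis at each place.\<close>

lemma power_family_span:
  fixes P Q :: "'a::field poly"
  assumes "m < Suc s * Suc s"
  shows "\<exists>c. power_family k s \<gamma> (smult a P + smult b Q) (smult a' P + smult b' Q) m
    = (\<Sum>j<Suc s * Suc s. smult (c j) (power_family k s 0 P Q j))"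
proof -
  let ?X = "monom 1 k :: 'a poly"
  have i: "m div Suc s \<le> s" using less_mult_imp_div_less[OF assms] by simp
  have j: "m mod Suc s \<le> s" using mod_less_divisor[of "Suc s" m] by simp
  have eq: "?X + [:- \<gamma>:] = ?X - [:\<gamma>:]" by simp
  \<comment> \<open>\<open>(x ^ k - \<gamma>) ^ i\<close> is read as a binary form in
    \<open>x ^ k\<close> and 1, padded to degree \<open>s\<close> with factors 1.\<close>
  obtain u where u: "(?X - [:\<gamma>:]) ^ (m div Suc s) = (\<Sum>i\<le>s. smult (u i) (?X ^ i))"
    using homogeneous_span[of 1 ?X "- \<gamma>" 1 "m div Suc s" 0 1 "s - m div Suc s"] i eq
    by (auto simp: pCons_one)
  obtain v where v: "(smult a P + smult b Q) ^ (m mod Suc s) * (smult a' P + smult b' Q) ^ (s - m mod Suc s)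
      = (\<Sum>j\<le>s. smult (v j) (P ^ j * Q ^ (s - j)))"
    using homogeneous_span[of a P b Q "m mod Suc s" a' b' "s - m mod Suc s"] j by auto
  have "power_family k s \<gamma> (smult a P + smult b Q) (smult a' P + smult b' Q) m
    = (\<Sum>i\<le>s. smult (u i) (?X ^ i)) * (\<Sum>j\<le>s. smult (v j) (P ^ j * Q ^ (s - j)))"
    unfolding power_family_def by (simp only: mult.assoc u v)
  also have "\<dots> = (\<Sum>i<Suc s. \<Sum>j<Suc s. smult (u i * v j) (?X ^ i * P ^ j * Q ^ (s - j)))"
    by (simp add: sum_product lessThan_Suc_atMost mult_ac)
  also have "\<dots> = (\<Sum>m<Suc s * Suc s. smult (u (m div Suc s) * v (m mod Suc s)) (power_family k s 0 P Q m))"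
    unfolding power_family_def mult_zero_left
    by (subst sum_div_mod[of "Suc s" "\<lambda>i j. smult (u i * v j) (?X ^ i * P ^ j * Q ^ (s - j))", symmetric])
      simp_all
  finally show ?thesis
    by (rule exI[of _ "\<lambda>m. u (m div Suc s) * v (m mod Suc s)"])
qed

text \<open>Each of the two digits of \<open>m\<close> averages \<open>s / 2\<close> over the whole
  index square; the sum is doubled to stay within the natural numbers.\<close>

lemma sum_bilinear_index: "2 * (\<Sum>m<Suc s * Suc s. u * (m div Suc s) + v * (m mod Suc s))
    = Suc s * Suc s * s * (u + v :: nat)"
proof -
  have *: "2 * (\<Sum>i<Suc s. i) = s * Suc s"
    by (induction s) auto
  have "(\<Sum>m<Suc s * Suc s. u * (m div Suc s) + v * (m mod Suc s))
    = (\<Sum>i<Suc s. \<Sum>j<Suc s. u * i + v * j)"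
    by (rule sum_div_mod[of "Suc s" "\<lambda>i j. u * i + v * j"]) simp
  also have "\<dots> = Suc s * (u + v) * (\<Sum>i<Suc s. i)"
    by (simp only: sum.distrib sum_constant card_lessThan sum_distrib_left[symmetric]) (simp add: algebra_simps)
  also have "2 * (Suc s * (u + v) * (\<Sum>i<Suc s. i)) = Suc s * (u + v) * (2 * (\<Sum>i<Suc s. i))"
    by (simp only: mult_ac)
  also have "\<dots> = Suc s * Suc s * s * (u + v)"
    unfolding * by (simp only: mult_ac)
  finally show ?thesis .
qed

subsection \<open>Counting coset points\<close>

lemma sum_pred: "2 * (\<Sum>l<Suc n. l - 1) = n * (n - 1)"
proof (induction n)
  case (Suc n)
  then show ?case by (cases n) auto
qed simp

text \<open>Cancellation of the leading terms: this difference plays at infinity the part that a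
  zero plays at the finite places.\<close>

lemma degree_power_diff_less:
  fixes a b :: "'a::field"
  assumes "0 < k"
  shows "degree ([:- b, 1:] ^ k - [:- a, 1:] ^ k) \<le> k - 1"
proof -
  have "coeff ([:- b, 1:] ^ k - [:- a, 1:] ^ k) k = 0"
    using coeff_linear_power[of "- a" k] coeff_linear_power[of "- b" k] by simp
  moreover have "degree ([:- b, 1:] ^ k - [:- a, 1:] ^ k) \<le> k"
    by (rule degree_diff_le) (simp_all add: degree_linear_power)
  ultimately have "\<forall>i > k - 1. coeff ([:- b, 1:] ^ k - [:- a, 1:] ^ k) i = 0"
    using assms by (metis Suc_diff_1 Suc_lessI coeff_eq_0 le_less_trans)
  then show ?thesis by (intro degree_le) auto
qed

lemma degree_mult_power_le:
  fixes f g :: "'a::field poly"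
  assumes "degree f \<le> d" "degree g \<le> e"
  shows "degree (f * g ^ i) \<le> d + e * i"
proof -
  have "degree (f * g ^ i) \<le> degree f + degree g * i"
    using degree_mult_le[of f "g ^ i"] degree_power_le[of g i] by linarith
  also have "\<dots> \<le> d + e * i" using assms by (intro add_mono mult_right_mono) auto
  finally show ?thesis .
qed

lemma degree_power_family_le:
  assumes "degree P \<le> d" "degree Q \<le> e"
  shows "degree (power_family k s \<gamma> P Q m) \<le> k * (m div Suc s) + d * (m mod Suc s) + e * (s - m mod Suc s)"
proof -
  have "degree (monom 1 k - [:\<gamma>:]) \<le> k"
    by (rule degree_diff_le) (auto simp: degree_monom_le)
  then have "degree (1 * (monom 1 k - [:\<gamma>:]) ^ (m div Suc s)) \<le> 0 + k * (m div Suc s)"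
    by (intro degree_mult_power_le) auto
  then show ?thesis
    unfolding power_family_def using assms by (intro degree_mult_power_le) auto
qed

text \<open>The adapted basis changes the determinant only by a nonzero constant. The orders at
  \<open>z\<close> sum to half the left-hand side; the column of values costs at most
  \<open>(u + v) * s\<close> and the derivatives cost the sum of their orders.\<close>

lemma bordered_order_power_family:
  fixes P Q :: "'a::field poly"
  assumes indep: "lin_indep (Suc s * Suc s) (power_family k s \<gamma> (smult a P + smult b Q) (smult a' P + smult b' Q))"
    and w: "\<And>m. m < Suc s * Suc s \<Longrightarrow> [:- z, 1:] ^ (u * (m div Suc s) + v * (m mod Suc s))
      dvd power_family k s \<gamma> (smult a P + smult b Q) (smult a' P + smult b' Q) m"
    and nz: "bordered x (Suc s * Suc s) (power_family k s 0 P Q) \<noteq> 0"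
  shows "Suc s * Suc s * s * (u + v) \<le> 2 * (u + v) * s + 2 * (\<Sum>l<Suc s * Suc s. l - 1)
    + 2 * order z (bordered x (Suc s * Suc s) (power_family k s 0 P Q))"
proof -
  let ?L = "Suc s * Suc s"
  let ?G = "power_family k s \<gamma> (smult a P + smult b Q) (smult a' P + smult b' Q)"
  let ?W = "bordered x ?L (power_family k s 0 P Q)"
  let ?w = "\<lambda>m. u * (m div Suc s) + v * (m mod Suc s)"
  let ?C = "\<Sum>l<?L. l - 1"
  have "\<forall>m. \<exists>c. m < ?L \<longrightarrow> ?G m = (\<Sum>j<?L. smult (c j) (power_family k s 0 P Q j))"
    using power_family_span by blast
  then obtain C where C: "\<And>m. m < ?L \<Longrightarrow> ?G m = (\<Sum>j<?L. smult (C m j) (power_family k s 0 P Q j))"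
    by metis
  obtain e where e: "e \<noteq> 0" "bordered x ?L ?G = smult e ?W"
    using bordered_change_of_family[OF indep C] by blast
  have "?w m \<le> (u + v) * s" if "m < ?L" for m
  proof -
    have "m div Suc s \<le> s" using less_mult_imp_div_less[OF that] by simp
    moreover have "m mod Suc s \<le> s" using mod_less_divisor[of "Suc s" m] by simp
    ultimately show ?thesis unfolding add_mult_distrib by (intro add_mono mult_left_mono) auto
  qed
  then have "[:- z, 1:] ^ ((\<Sum>m<?L. ?w m) - (u + v) * s) dvd [:- z, 1:] ^ ?C * bordered x ?L ?G"
    by (intro bordered_order w) auto
  then have "[:- z, 1:] ^ ((\<Sum>m<?L. ?w m) - (u + v) * s) dvd [:- z, 1:] ^ ?C * ?W"
    using e by (simp add: dvd_smult_iff)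
  moreover have "[:- z, 1:] ^ ?C * ?W \<noteq> 0" using nz by simp
  ultimately have "(\<Sum>m<?L. ?w m) - (u + v) * s \<le> order z ([:- z, 1:] ^ ?C * ?W)"
    by (simp only: order_divides) simp
  also have "\<dots> = ?C + order z ?W"
    using nz by (subst order_mult) (simp_all add: order_power_n_n)
  finally show ?thesis
    using sum_bilinear_index[where u = u and v = v and s = s] by linarith
qed

text \<open>The same argument at infinity, with a first form of degree at most \<open>k - 1\<close>.
  All terms are moved to the side where they are added, which avoids truncated subtraction.\<close>

lemma bordered_degree_power_family:
  fixes P Q :: "'a::field poly"
  assumes indep: "lin_indep (Suc s * Suc s) (power_family k s \<gamma> (smult a P + smult b Q) (smult a' P + smult b' Q))"
    and deg: "degree (smult a P + smult b Q) \<le> k - 1" "degree (smult a' P + smult b' Q) \<le> k" and "0 < k"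
    and nz: "bordered x (Suc s * Suc s) (power_family k s 0 P Q) \<noteq> 0"
  shows "2 * ((\<Sum>l<Suc s * Suc s. l - 1) + degree (bordered x (Suc s * Suc s) (power_family k s 0 P Q)) + k * s)
    + Suc s * Suc s * s \<le> 3 * (Suc s * Suc s * s * k) + 2 * s"
proof -
  let ?L = "Suc s * Suc s"
  let ?G = "power_family k s \<gamma> (smult a P + smult b Q) (smult a' P + smult b' Q)"
  let ?W = "bordered x ?L (power_family k s 0 P Q)"
  let ?C = "\<Sum>l<?L. l - 1"
  let ?d = "\<lambda>m. k * (m div Suc s) + (k - 1) * (m mod Suc s) + k * (s - m mod Suc s)"
  have "\<forall>m. \<exists>c. m < ?L \<longrightarrow> ?G m = (\<Sum>j<?L. smult (c j) (power_family k s 0 P Q j))"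
    using power_family_span by blast
  then obtain C where C: "\<And>m. m < ?L \<Longrightarrow> ?G m = (\<Sum>j<?L. smult (C m j) (power_family k s 0 P Q j))"
    by metis
  obtain e where e: "e \<noteq> 0" "bordered x ?L ?G = smult e ?W"
    using bordered_change_of_family[OF indep C] by blast
  \<comment> \<open>The degree bound for digits \<open>i\<close>, \<open>j\<close> is
    \<open>k * i + k * s - j\<close>; its least possible value \<open>k * s - s\<close> is what the
    column of values saves.\<close>
  have d: "?d m + m mod Suc s = k * (m div Suc s) + k * s" for m
  proof -
    have "m mod Suc s \<le> s" using mod_less_divisor[of "Suc s" m] by simp
    then have "k * (s - m mod Suc s) + k * (m mod Suc s) = k * s"
      by (simp flip: add_mult_distrib2)
    moreover have "(k - 1) * (m mod Suc s) + m mod Suc s = k * (m mod Suc s)"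
      using \<open>0 < k\<close> by (cases k) auto
    ultimately show ?thesis by linarith
  qed
  have low: "k * s - s \<le> ?d m" for m
  proof -
    have "m mod Suc s \<le> s" using mod_less_divisor[of "Suc s" m] by simp
    then show ?thesis using d[of m] by linarith
  qed
  have "degree ([:0, 1:] ^ ?C * bordered x ?L ?G) + (k * s - s) \<le> (\<Sum>m<?L. ?d m)"
    by (rule bordered_degree) (use low deg degree_power_family_le in auto)
  moreover have "degree ([:0, 1:] ^ ?C * bordered x ?L ?G) = ?C + degree ?W"
    using e nz by (simp add: degree_mult_eq degree_linear_power degree_power_eq)
  moreover have "(\<Sum>m<?L. ?d m) + (\<Sum>m<?L. m mod Suc s) = (\<Sum>m<?L. k * (m div Suc s)) + ?L * (k * s)"
  proof -
    have "(\<Sum>m<?L. ?d m) + (\<Sum>m<?L. m mod Suc s) = (\<Sum>m<?L. k * (m div Suc s) + k * s)"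
      unfolding sum.distrib[symmetric] by (rule sum.cong[OF refl d])
    then show ?thesis by (simp only: sum.distrib sum_constant card_lessThan of_nat_id)
  qed
  moreover have "2 * (\<Sum>m<?L. m mod Suc s) = ?L * s"
    using sum_bilinear_index[where u = 0 and v = 1 and s = s] by simp
  moreover have "2 * (\<Sum>m<?L. k * (m div Suc s)) = ?L * s * k"
    using sum_bilinear_index[where u = k and v = 0 and s = s] by simp
  moreover have "?L * (k * s) = ?L * s * k" by (simp only: mult_ac)
  moreover have "s \<le> k * s" using \<open>0 < k\<close> by simp
  moreover have "2 * (C + D + ks) + Ls \<le> 3 * Lsk + 2 * s"
    if "dG + (ks - s) \<le> Sd" "dG = C + D" "Sd + Sm = Sk + Lks" "2 * Sm = Ls" "2 * Sk = Lsk"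
      "Lks = Lsk" "s \<le> ks" for C D ks Ls Lsk s dG Sd Sm Sk Lks :: nat
  proof -
    have "C + D + ks \<le> Sd + s" using that(1,2,7) by linarith
    moreover have "2 * Sd + Ls = 3 * Lsk" using that(3-6) by linarith
    ultimately show ?thesis unfolding distrib_left by linarith
  qed
  ultimately show ?thesis by blast
qed

text \<open>With \<open>n = L - 1\<close>, twice the order of \<open>W\<close> is at least
  \<open>L * s * (k + 1) - 2 * (k + 1) * s - n * (n - 1)\<close> at each of \<open>0\<close>,
  \<open>a\<close>, \<open>\<beta>\<close>, and at least \<open>2 * n\<close> at each point of
  \<open>S\<close>. Twice the degree is at most
  \<open>3 * L * s * k + 2 * s - L * s - 2 * k * s - n * (n - 1)\<close>.\<close>

theorem card_coset_pairs_bound: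
  fixes a \<beta> c d :: "'a::field"
  assumes nz: "a \<noteq> 0" "\<beta> \<noteq> 0" "a \<noteq> \<beta>" "c \<noteq> 0" "d \<noteq> 0"
    and s: "1 \<le> s" "s < k"
    and char: "\<And>i. 0 < i \<Longrightarrow> i \<le> 2 * (s * k) \<Longrightarrow> of_nat i \<noteq> (0::'a)"
    and S: "finite S" "\<And>x. x \<in> S \<Longrightarrow> x ^ k = c \<and> (x - a) ^ k = d * (x - \<beta>) ^ k"
  shows "card S * (s + 2) + s \<le> 2 * k + s ^ 3 + 2 * s\<^sup>2"
proof (cases "S = {}")
  case True
  then show ?thesis using s by simp
next
  case False
  then obtain x where x: "x \<in> S" by blast
  define n where "n = s * (s + 2)"
  define L where "L = Suc s * Suc s"
  have L: "L = Suc n" by (simp add: L_def n_def)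
  define A where "A = [:- a, 1:] ^ k"
  define B where "B = [:- \<beta>, 1:] ^ k"
  define F where "F = power_family k s 0 A B"
  define h where "h = (\<Prod>x\<in>S. [:- x, 1:])"
  define W where "W = bordered x L F"
  have k: "0 < k" using s by simp
  have k0: "of_nat k \<noteq> (0::'a)"
  proof (rule char)
    show "k \<le> 2 * (s * k)" using s by (cases s) auto
  qed (use k in simp)
  have AB: "A \<noteq> 0" "B \<noteq> 0" "degree A = k" "degree B = k"
    by (auto simp: A_def B_def degree_linear_power)
  have polyAB: "poly A z = (z - a) ^ k" "poly B z = (z - \<beta>) ^ k" for z
    by (auto simp: A_def B_def poly_power)
  have [simp]: "poly A \<beta> \<noteq> 0" "poly B a \<noteq> 0"
    using nz by (auto simp: polyAB)
  have indep: "lin_indep L F"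
    unfolding L_def F_def
    by (rule lin_indep_power_family[where \<alpha> = \<beta>]) (use k0 s nz AB in \<open>auto simp: B_def\<close>)
  have h0: "h \<noteq> 0" by (auto simp: h_def S(1))
  have "poly h x = 0" using x S(1) by (auto simp: h_def poly_prod)
  \<comment> \<open>\<open>S\<close> avoids the three special places, so the orders can be added
    without overlap, and \<open>F 0\<close> does not vanish at \<open>x\<close>.\<close>
  have outside: "z - \<beta> \<noteq> 0" "z \<noteq> 0" "z - a \<noteq> 0" if "z \<in> S" for z
    using S(2)[OF that] nz k by (auto simp: power_0_left)
  \<comment> \<open>\<open>e m\<close> is the common value of \<open>F m / F 0\<close> on
    \<open>S\<close>.\<close>
  define e where "e m = c ^ (m div Suc s) * d ^ (m mod Suc s)" for m
  have F0: "F 0 = B ^ s" by (simp add: F_def power_family_def)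
  have van: "poly (F m - smult (e m) (F 0)) z = 0" if "z \<in> S" for m z
  proof -
    have "m mod Suc s \<le> s" using mod_less_divisor[of "Suc s" m] by simp
    then have "((z - \<beta>) ^ k) ^ (m mod Suc s) * ((z - \<beta>) ^ k) ^ (s - m mod Suc s) = ((z - \<beta>) ^ k) ^ s"
      by (simp flip: power_add)
    then show ?thesis
      using S(2)[OF that]
      by (simp add: F0 F_def power_family_def e_def polyAB poly_power poly_monom power_mult_distrib)
  qed
  have "h dvd F m - smult (e m) (F 0)" for m
  proof -
    have "[:- z, 1:] ^ 1 dvd F m - smult (e m) (F 0)" if "z \<in> S" for z
      using van[OF that] by (simp only: poly_eq_0_iff_dvd power_one_right)
    then have "(\<Prod>z\<in>S. [:- z, 1:] ^ 1) dvd F m - smult (e m) (F 0)"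
      by (rule prod_linear_powers_dvd[OF S(1)])
    then show ?thesis by (simp only: h_def power_one_right)
  qed
  then have "\<exists>q. F m - smult (e m) (F 0) = h * q" for m
    by (auto elim: dvdE)
  then obtain q' where q': "\<And>m. F m - smult (e m) (F 0) = h * q' m" by metis
  define q where "q m = q' (Suc m)" for m
  have Fq: "F (Suc m) = smult (e (Suc m)) (F 0) + h * q m" for m
    using q'[of "Suc m"] by (simp add: q_def algebra_simps)
  \<comment> \<open>A relation among the \<open>q m\<close>, multiplied by \<open>h\<close>, becomes
    a relation among the \<open>F m\<close> in which \<open>F 0\<close> absorbs all the multiples
    \<open>e m\<close>.\<close>
  have indep_q: "lin_indep n q"
    unfolding lin_indep_def
  proof (intro allI impI)
    fix f m assume eq: "(\<Sum>m<n. smult (f m) (q m)) = 0" and m: "m < n"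
    define g where "g m = (case m of 0 \<Rightarrow> - (\<Sum>m<n. f m * e (Suc m)) | Suc m \<Rightarrow> f m)" for m
    have "(\<Sum>m<L. smult (g m) (F m))
      = smult (g 0) (F 0) + (\<Sum>m<n. smult (f m) (F (Suc m)))"
      unfolding L by (subst sum.lessThan_Suc_shift) (simp add: g_def)
    also have "(\<Sum>m<n. smult (f m) (F (Suc m)))
      = smult (\<Sum>m<n. f m * e (Suc m)) (F 0) + h * (\<Sum>m<n. smult (f m) (q m))"
      by (simp add: Fq smult_add_right sum.distrib sum_distrib_left smult_sum)
    finally have "(\<Sum>m<L. smult (g m) (F m)) = 0"
      using eq by (simp add: g_def)
    with indep have "\<forall>m<L. g m = 0" unfolding lin_indep_def by blast
    then have "g (Suc m) = 0" using m L by simp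
    then show "f m = 0" by (simp add: g_def)
  qed
  have degF: "degree (F m) \<le> 2 * (s * k)" if "m < L" for m
  proof -
    have "degree (F m) \<le> k * (m div Suc s) + k * (m mod Suc s) + k * (s - m mod Suc s)"
      unfolding F_def by (rule degree_power_family_le) (simp_all add: AB)
    also have "\<dots> \<le> k * s + k * s"
    proof -
      have "m div Suc s \<le> s" using less_mult_imp_div_less[of m "Suc s" "Suc s"] that by (simp add: L_def)
      moreover have "m mod Suc s \<le> s" using mod_less_divisor[of "Suc s" m] by simp
      ultimately show ?thesis
        by (simp add: add.assoc flip: add_mult_distrib2)
    qed
    finally show ?thesis by (simp add: mult.commute)
  qed
  \<comment> \<open>Division by \<open>h\<close> does not raise degrees, so the assumption on the
    characteristic also covers the Wronskian of \<open>q\<close>.\<close>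
  have degq: "degree (q m) \<le> 2 * (s * k)" if "m < n" for m
  proof (cases "q m = 0")
    case False
    have "degree (q m) \<le> degree (h * q m)"
      using False h0 by (simp add: degree_mult_eq)
    also have "h * q m = F (Suc m) - smult (e (Suc m)) (F 0)" using Fq[of m] by simp
    also have "degree \<dots> \<le> 2 * (s * k)"
      using degF[of "Suc m"] degF[of 0] that L
      by (intro degree_diff_le) (auto intro: order_trans[OF degree_smult_le])
    finally show ?thesis .
  qed simp
  have "wronskian n q \<noteq> 0"
    using wronskian_nonzero[OF indep_q degq char] by blast
  moreover obtain b where "b \<noteq> 0" "W = smult (b * poly (F 0) x) (h ^ n * wronskian n q)"
    using bordered_factor[of n F "\<lambda>m. e (Suc m)" h q x] indep Fq \<open>poly h x = 0\<close>
    unfolding L W_def by metis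
  moreover have "poly (F 0) x \<noteq> 0"
    using outside[OF x] by (simp add: F0 polyAB)
  ultimately have W: "W \<noteq> 0" "h ^ n dvd W" using h0 by (auto simp: dvd_smult)
  have ordS: "n \<le> order z W" if "z \<in> S" for z
  proof -
    have "[:- z, 1:] dvd h" unfolding h_def using S(1) that by (rule dvd_prodI)
    then have "[:- z, 1:] ^ n dvd W" using W(2) dvd_power_same dvd_trans by blast
    then show ?thesis using W(1) by (simp add: order_divides)
  qed
  let ?C = "\<Sum>l<L. l - 1"
  have nzW: "bordered x L (power_family k s 0 A B) \<noteq> 0" using W by (simp add: W_def F_def)
  \<comment> \<open>\<open>r\<close> is \<open>A / B\<close> at 0, so \<open>A - r * B\<close> has a
    zero there, while \<open>x ^ k\<close> has order \<open>k\<close>.\<close>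
  define r where "r = (a / \<beta>) ^ k"
  have ord0: "L * s * (k + 1) \<le> 2 * (k + 1) * s + 2 * ?C + 2 * order 0 W"
    unfolding W_def F_def L_def
  proof (rule bordered_order_power_family[where \<gamma> = 0 and a = 1 and b = "- r" and a' = 0 and b' = 1])
    show "lin_indep (Suc s * Suc s) (power_family k s 0 (smult 1 A + smult (- r) B) (smult 0 A + smult 1 B))"
      by (rule lin_indep_power_family[where \<alpha> = \<beta>]) (use k0 s nz AB in \<open>auto simp: B_def power_0_left\<close>)
    have "poly (smult 1 A + smult (- r) B) 0 = 0"
      using nz by (simp add: polyAB r_def flip: power_mult_distrib)
    then have "[:- 0, 1:] dvd smult 1 A + smult (- r) B" by (simp only: poly_eq_0_iff_dvd)
    moreover have "(monom 1 k - [:0:] :: 'a poly) = [:- 0, 1:] ^ k" by (simp add: monom_altdef)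
    ultimately show "[:- 0, 1:] ^ (k * (m div Suc s) + 1 * (m mod Suc s))
        dvd power_family k s 0 (smult 1 A + smult (- r) B) (smult 0 A + smult 1 B) m" for m
      unfolding power_family_def power_add power_mult
      by (intro dvd_mult2 mult_dvd_mono dvd_power_same) (simp_all del: minus_zero)
  qed (use nzW in \<open>simp add: L_def\<close>)
  have "[:- z, 1:] dvd monom 1 k - [:z ^ k:]" for z :: 'a
    by (simp add: poly_eq_0_iff_dvd[symmetric] poly_monom)
  note shift = this
  \<comment> \<open>At \<open>a\<close> the weights are exchanged: \<open>x ^ k - a ^ k\<close>
    gives one zero and \<open>A\<close> gives \<open>k\<close>.\<close>
  have orda: "L * s * (1 + k) \<le> 2 * (1 + k) * s + 2 * ?C + 2 * order a W"
    unfolding W_def F_def L_def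
  proof (rule bordered_order_power_family[where \<gamma> = "a ^ k" and a = 1 and b = 0 and a' = 0 and b' = 1])
    show "lin_indep (Suc s * Suc s) (power_family k s (a ^ k) (smult 1 A + smult 0 B) (smult 0 A + smult 1 B))"
      by (rule lin_indep_power_family[where \<alpha> = \<beta>]) (use k0 s nz AB in \<open>auto simp: B_def\<close>)
    show "[:- a, 1:] ^ (1 * (m div Suc s) + k * (m mod Suc s))
        dvd power_family k s (a ^ k) (smult 1 A + smult 0 B) (smult 0 A + smult 1 B) m" for m
      unfolding power_family_def power_add power_mult power_one_right
      by (intro dvd_mult2 mult_dvd_mono dvd_power_same shift) (simp add: A_def)
  qed (use nzW in \<open>simp add: L_def\<close>)
  \<comment> \<open>\<open>A\<close> and \<open>B\<close> change places, so independence is now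
    tested at \<open>a\<close>, where the second form \<open>A\<close> has order
    \<open>k\<close>.\<close>
  have ordb: "L * s * (1 + k) \<le> 2 * (1 + k) * s + 2 * ?C + 2 * order \<beta> W"
    unfolding W_def F_def L_def
  proof (rule bordered_order_power_family[where \<gamma> = "\<beta> ^ k" and a = 0 and b = 1 and a' = 1 and b' = 0])
    show "lin_indep (Suc s * Suc s) (power_family k s (\<beta> ^ k) (smult 0 A + smult 1 B) (smult 1 A + smult 0 B))"
      by (rule lin_indep_power_family[where \<alpha> = a]) (use k0 s nz AB in \<open>auto simp: A_def\<close>)
    show "[:- \<beta>, 1:] ^ (1 * (m div Suc s) + k * (m mod Suc s))
        dvd power_family k s (\<beta> ^ k) (smult 0 A + smult 1 B) (smult 1 A + smult 0 B) m" for m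
      unfolding power_family_def power_add power_mult power_one_right
      by (intro dvd_mult2 mult_dvd_mono dvd_power_same shift) (simp add: B_def)
  qed (use nzW in \<open>simp add: L_def\<close>)
  \<comment> \<open>At infinity the first form is \<open>B - A\<close>, whose leading terms
    cancel.\<close>
  have deg: "2 * (?C + degree W + k * s) + L * s \<le> 3 * (L * s * k) + 2 * s"
    unfolding W_def F_def L_def
  proof (rule bordered_degree_power_family[where \<gamma> = 0 and a = "- 1" and b = 1 and a' = 1 and b' = 0])
    show "lin_indep (Suc s * Suc s) (power_family k s 0 (smult (- 1) A + smult 1 B) (smult 1 A + smult 0 B))"
      by (rule lin_indep_power_family[where \<alpha> = a]) (use k0 s nz AB in \<open>auto simp: A_def power_0_left\<close>)
    show "degree (smult (- 1) A + smult 1 B) \<le> k - 1"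
      using degree_power_diff_less[OF k, of \<beta> a] by (simp add: A_def B_def)
  qed (use nzW AB k in \<open>auto simp: L_def\<close>)
  have "card S * n \<le> (\<Sum>z\<in>S. order z W)"
    using sum_bounded_below[of S n "\<lambda>z. order z W"] ordS by simp
  moreover have "(\<Sum>z\<in>S \<union> {0, a, \<beta>}. order z W) \<le> degree W"
    by (rule sum_order_le_degree) (use S(1) W in auto)
  moreover have "(\<Sum>z\<in>S \<union> {0, a, \<beta>}. order z W)
      = (\<Sum>z\<in>S. order z W) + (order 0 W + (order a W + order \<beta> W))"
    using S(1) outside nz by (subst sum.union_disjoint) auto
  ultimately have total: "card S * n + order 0 W + order a W + order \<beta> W \<le> degree W" by linarith
  have C: "2 * ?C = n * (n - 1)" unfolding L by (rule sum_pred)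
  have "2 * (card S * n) + 3 * (L * s * (k + 1)) + L * s + 2 * (k * s)
      \<le> 6 * ((k + 1) * s) + 2 * (n * (n - 1)) + 3 * (L * s * k) + 2 * s"
  proof -
    \<comment> \<open>Every nonlinear product is replaced by a variable, which leaves a purely
      linear inequality.\<close>
    have "2 * Nn + 3 * X + Z + 2 * K \<le> 6 * Y + 2 * T + 3 * V + 2 * s"
      if "X \<le> 2 * Y + 2 * C + 2 * w0" "X \<le> 2 * Y + 2 * C + 2 * w1" "X \<le> 2 * Y + 2 * C + 2 * w2"
        "2 * C + 2 * D + 2 * K + Z \<le> 3 * V + 2 * s" "Nn + w0 + w1 + w2 \<le> D" "2 * C = T"
      for Nn X Y Z K V T C D w0 w1 w2 :: nat
      using that by linarith
    moreover have "2 * ?C + 2 * degree W + 2 * (k * s) + L * s \<le> 3 * (L * s * k) + 2 * s"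
      using deg by (simp only: distrib_left)
    ultimately show ?thesis
      using ord0 orda ordb total C unfolding add.commute[of 1 k] mult.assoc[of 2] by blast
  qed
  then have "int (2 * (card S * n) + 3 * (L * s * (k + 1)) + L * s + 2 * (k * s))
      \<le> int (6 * ((k + 1) * s) + 2 * (n * (n - 1)) + 3 * (L * s * k) + 2 * s)"
    by (simp only: of_nat_le_iff)
  moreover have "int (n * (n - 1)) = int n * (int n - 1)"
    by (cases n) (auto simp: algebra_simps)
  ultimately have ineq: "2 * (int (card S) * int n) + 3 * (int L * int s * (int k + 1)) + int L * int s + 2 * (int k * int s)
      \<le> 6 * ((int k + 1) * int s) + 2 * (int n * (int n - 1)) + 3 * (int L * int s * int k) + 2 * int s"
    by (simp only: of_nat_add of_nat_mult of_nat_numeral of_nat_1)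
  have Ln: "int L = (int s + 1)\<^sup>2" "int n = int s * (int s + 2)"
    by (simp_all add: L_def n_def power2_eq_square algebra_simps)
  \<comment> \<open>The difference of the two sides of \<open>ineq\<close> is \<open>2 * s\<close>
    times the difference of the two sides of the claim; \<open>K\<close>, \<open>X\<close>,
    \<open>N\<close> stand for \<open>k\<close>, \<open>s\<close>, \<open>card S\<close>.\<close>
  have identity: "6 * ((K + 1) * X) + 2 * (X * (X + 2) * (X * (X + 2) - 1)) + 3 * ((X + 1)\<^sup>2 * X * K) + 2 * X
      - (2 * (N * (X * (X + 2))) + 3 * ((X + 1)\<^sup>2 * X * (K + 1)) + (X + 1)\<^sup>2 * X + 2 * (K * X))
      = 2 * X * (2 * K + X ^ 3 + 2 * X\<^sup>2 - (N * (X + 2) + X))" for K X N :: int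
    by (simp add: power2_eq_square power3_eq_cube algebra_simps)
  have "0 \<le> 2 * int s * (2 * int k + int s ^ 3 + 2 * (int s)\<^sup>2 - (int (card S) * (int s + 2) + int s))"
    using ineq unfolding Ln identity[symmetric] by (simp only: diff_ge_0_iff_ge)
  then have "int (card S) * (int s + 2) + int s \<le> 2 * int k + int s ^ 3 + 2 * (int s)\<^sup>2"
    using s by (simp add: zero_le_mult_iff)
  then have "int (card S * (s + 2) + s) \<le> int (2 * k + s ^ 3 + 2 * s\<^sup>2)" by (simp add: algebra_simps)
  then show ?thesis by (simp only: of_nat_le_iff)
qed

subsection \<open>The choice of the degree\<close>

text \<open>
  \<open>s\<close> is the least number for which the hypothesis on \<open>n\<close> holds with \<open>2 * s + 1\<close> in place of \<open>n\<close>;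
  this confines \<open>(k / 2) powr (1 / 3)\<close> to the interval \<open>[s, s + 1.62]\<close>.
\<close>

lemma exists_box_size:
  fixes n k :: nat
  assumes "3 \<le> n" "5 \<le> k"
    and "12 * (k + 3) \<le> (n + 3) * (n + 4) * (3 * n - 1)"
  obtains s where "1 \<le> s" "2 * s \<le> n" "s < k"
    "3 * (k + 3) \<le> (s + 2) * (2 * s + 5) * (3 * s + 1)"
    "s = 1 \<or> (s + 1) * (2 * s + 3) * (3 * s - 2) < 3 * (k + 3)"
proof -
  let ?good = "\<lambda>s. 1 \<le> s \<and> 3 * (k + 3) \<le> (s + 2) * (2 * s + 5) * (3 * s + 1)"
  define s0 where "s0 = n div 2"
  have s0: "1 \<le> s0" "2 * s0 \<le> n" "n \<le> 2 * s0 + 1" using assms(1) by (auto simp: s0_def)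
  \<comment> \<open>Since \<open>n \<le> 2 * s0 + 1\<close>, the hypothesis carries over to
    \<open>s0\<close>, and the least suitable \<open>s\<close> is at most \<open>s0\<close>.\<close>
  have "(n + 3) * (n + 4) * (3 * n - 1) \<le> (2 * s0 + 4) * (2 * s0 + 5) * (6 * s0 + 2)"
    using s0 by (intro mult_le_mono) auto
  also have "\<dots> = 4 * ((s0 + 2) * (2 * s0 + 5) * (3 * s0 + 1))" by (simp add: algebra_simps)
  finally have "?good s0" using assms(3) s0 by simp
  define s where "s = (LEAST s. ?good s)"
  have s: "?good s" "s \<le> s0"
    using LeastI[of ?good, OF \<open>?good s0\<close>] Least_le[of ?good, OF \<open>?good s0\<close>] by (auto simp: s_def)
  \<comment> \<open>By minimality the condition fails at \<open>s - 1\<close>; the product on the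
    left is its right-hand side there.\<close>
  have low: "(s + 1) * (2 * s + 3) * (3 * s - 2) < 3 * (k + 3)" if "s \<noteq> 1"
  proof -
    define r where "r = s - 1"
    then have r: "s = Suc r" "1 \<le> r" using s(1) that by auto
    then have "\<not> ?good r" using not_less_Least[of r ?good] by (simp add: s_def)
    then show ?thesis using r by (simp add: algebra_simps)
  qed
  have "s < k"
  proof (cases "s = 1")
    case False
    then have "(s + 1) * 7 * 4 \<le> (s + 1) * (2 * s + 3) * (3 * s - 2)"
      using s(1) by (intro mult_le_mono) auto
    with low[OF False] show ?thesis by simp
  qed (use assms in simp)
  moreover have "2 * s \<le> n" using s(2) s0(2) by simp
  ultimately show ?thesis using that s(1) low by blast
qed

text \<open>With \<open>\<sigma> = (k / 2) powr (1 / 3)\<close> one has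
  \<open>2 * k = 4 * \<sigma> ^ 3\<close>, and the cube root in the claim is
  \<open>sqrt 2 * \<sigma>\<close>. Writing \<open>\<sigma> = s + \<delta>\<close> leaves a
  polynomial inequality in \<open>s \<ge> 1\<close> and a bounded \<open>\<delta>\<close>.\<close>

lemma box_bound_numeric:
  fixes k s :: nat
  assumes "5 \<le> k" "1 \<le> s"
    and up: "3 * (k + 3) \<le> (s + 2) * (2 * s + 5) * (3 * s + 1)"
    and low: "s = 1 \<or> (s + 1) * (2 * s + 3) * (3 * s - 2) < 3 * (k + 3)"
    and N: "N * (s + 2) + s \<le> 2 * k + s ^ 3 + 2 * s\<^sup>2"
  shows "real N \<le> 3 * (sqrt 2 * real k) powr (2 / 3)
    - 103 / 19 * (sqrt 2 * real k) powr (1 / 3) + 13 / 3"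
proof -
  define \<sigma> where "\<sigma> = (real k / 2) powr (1 / 3)"
  define \<delta> where "\<delta> = \<sigma> - real s"
  define x where "x = real s"
  have x: "1 \<le> x" using assms(2) by (simp add: x_def)
  have cube: "w ^ 3 = w powr 3" if "w > 0" for w :: real
    using powr_realpow[OF that, of 3] by simp
  have square: "w ^ 2 = w powr 2" if "w > 0" for w :: real
    using powr_realpow[OF that, of 2] by simp
  have "\<sigma> > 0" using assms(1) by (simp add: \<sigma>_def)
  have \<sigma>3: "\<sigma> ^ 3 = real k / 2"
    unfolding cube[OF \<open>\<sigma> > 0\<close>] unfolding \<sigma>_def powr_powr by simp
  have two: "sqrt 2 ^ 3 = 2 * sqrt (2::real)" by (simp add: power3_eq_cube)
  have "(sqrt 2 * \<sigma>) ^ 3 = sqrt 2 * real k"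
    unfolding power_mult_distrib \<sigma>3 two by simp
  moreover have pos: "0 < sqrt 2 * \<sigma>" using \<open>\<sigma> > 0\<close> by simp
  ultimately have "(sqrt 2 * \<sigma>) powr 3 = sqrt 2 * real k"
    by (simp only: cube)
  then have "(sqrt 2 * real k) powr (1 / 3) = (sqrt 2 * \<sigma>) powr (3 * (1 / 3))"
    by (simp only: powr_powr[symmetric])
  then have t: "(sqrt 2 * real k) powr (1 / 3) = sqrt 2 * \<sigma>"
    using pos by simp
  have "(sqrt 2 * real k) powr (2 / 3) = ((sqrt 2 * real k) powr (1 / 3)) ^ 2"
    using assms(1) by (subst square) (auto simp: powr_powr simp del: powr_half_sqrt)
  also have "\<dots> = 2 * \<sigma> ^ 2" unfolding t by (simp add: power_mult_distrib)
  finally have t2: "(sqrt 2 * real k) powr (2 / 3) = 2 * \<sigma> ^ 2" .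
  have "real (3 * (k + 3)) \<le> real ((s + 2) * (2 * s + 5) * (3 * s + 1))"
    using up of_nat_le_iff by blast
  then have up': "3 * (2 * \<sigma> ^ 3 + 3) \<le> (x + 2) * (2 * x + 5) * (3 * x + 1)"
    unfolding \<sigma>3 x_def by (simp only: of_nat_mult of_nat_add of_nat_numeral of_nat_1) simp
  \<comment> \<open>\<open>up'\<close> bounds \<open>\<sigma> ^ 3\<close> by a cubic with quadratic
    coefficient 29/6; 1.62 slightly exceeds 29/18, so the cube of \<open>x + 1.62\<close> dominates
    it.\<close>
  have "\<sigma> \<le> x + 162 / 100"
  proof (rule ccontr)
    assume "\<not> ?thesis"
    then have "(x + 162 / 100) ^ 3 \<le> \<sigma> ^ 3" using x by (intro power_mono) auto
    also have "(x + 162 / 100) ^ 3 = x ^ 3 + 486 / 100 * x\<^sup>2 + 78732 / 10000 * x + 4251528 / 1000000"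
      by (simp add: power3_eq_cube power2_eq_square field_simps)
    finally have "x ^ 3 + 486 / 100 * x\<^sup>2 + 78732 / 10000 * x + 4251528 / 1000000 \<le> \<sigma> ^ 3" .
    moreover have "(x + 2) * (2 * x + 5) * (3 * x + 1) = 6 * x ^ 3 + 29 * x\<^sup>2 + 39 * x + 10"
      by (simp add: power3_eq_cube power2_eq_square algebra_simps)
    with up' have "6 * \<sigma> ^ 3 + 9 \<le> 6 * x ^ 3 + 29 * x\<^sup>2 + 39 * x + 10"
      by simp
    moreover have "0 \<le> x\<^sup>2" by simp
    ultimately show False using x by linarith
  qed
  \<comment> \<open>For \<open>s = 1\<close> this follows from \<open>k \<ge> 5\<close>, otherwise
    from the minimality expressed by \<open>low\<close>.\<close>
  moreover have "x \<le> \<sigma>"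
  proof (rule ccontr)
    assume "\<not> ?thesis"
    then have lt: "\<sigma> ^ 3 < x ^ 3" using \<open>\<sigma> > 0\<close> by (intro power_strict_mono) auto
    show False
    proof (cases "s = 1")
      case True
      then show False using lt assms(1) unfolding \<sigma>3 x_def by simp
    next
      case False
      have sub: "real (3 * s - 2) = 3 * real s - 2" using assms(2) by (simp add: of_nat_diff)
      from False have "real ((s + 1) * (2 * s + 3) * (3 * s - 2)) < real (3 * (k + 3))"
        using low of_nat_less_iff by blast
      then have "(x + 1) * (2 * x + 3) * (3 * x - 2) < 3 * (2 * \<sigma> ^ 3 + 3)"
        unfolding \<sigma>3 x_def by (simp only: of_nat_mult of_nat_add of_nat_numeral of_nat_1 sub) simp
      also have "(x + 1) * (2 * x + 3) * (3 * x - 2) = 6 * x ^ 3 + 11 * x\<^sup>2 - x - 6"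
        by (simp add: power3_eq_cube power2_eq_square algebra_simps)
      finally have "6 * x ^ 3 + 11 * x\<^sup>2 - x - 6 < 3 * (2 * \<sigma> ^ 3 + 3)" .
      moreover have "2 * x \<le> x\<^sup>2" "2 \<le> x" using False assms(2) by (auto simp: x_def power2_eq_square)
      moreover have False if "6 * u + 11 * w - x - 6 < 3 * (2 * v + 3)" "2 * x \<le> w" "2 \<le> x" "v < u"
        for u v w using that by argo
      ultimately show False using lt by blast
    qed
  qed
  ultimately have \<delta>: "0 \<le> \<delta>" "\<delta> \<le> 162 / 100" by (auto simp: \<delta>_def x_def)
  define z where "z = x - 1"
  have z: "0 \<le> z" using x by (simp add: z_def)
  \<comment> \<open>\<open>103 / 19\<close> is a close lower approximation of \<open>23 / (3 * sqrt 2)\<close>.\<close>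
  have "103 * 3 * sqrt 2 \<le> (437::real)"
  proof (rule power2_le_imp_le)
    show "(103 * 3 * sqrt 2)\<^sup>2 \<le> (437::real)\<^sup>2" by (simp add: power_mult_distrib)
  qed simp
  then have "103 / 19 * (sqrt 2 * \<sigma>) \<le> 23 / 3 * \<sigma>"
    using \<open>\<sigma> > 0\<close> by (simp add: field_simps)
  \<comment> \<open>The surplus of the claimed bound, multiplied by \<open>s + 2\<close>, over the
    available bound, expanded in \<open>\<delta>\<close> and \<open>z = s - 1\<close>.\<close>
  moreover have "(6 * \<sigma>\<^sup>2 - 23 / 3 * \<sigma> + 13 / 3) * (x + 2) - (4 * \<sigma> ^ 3 + x ^ 3 + 2 * x\<^sup>2 - x)
    = (2 + \<delta> + 6 * \<delta>\<^sup>2 - 4 * \<delta> ^ 3) + z * (49 / 3 * \<delta> - 6 * \<delta>\<^sup>2) - 7 / 3 * z + 16 / 3 * z\<^sup>2 + z ^ 3"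
  proof -
    have "\<sigma> = z + 1 + \<delta>" "x = z + 1" by (auto simp: z_def \<delta>_def x_def)
    then show ?thesis by (simp add: field_simps power2_eq_square power3_eq_cube)
  qed
  moreover have "\<dots> \<ge> 0"
  proof -
    \<comment> \<open>The part free of \<open>z\<close> is at least
      \<open>2 + \<delta> - 12 / 25 * \<delta>\<^sup>2\<close>, which leaves room to absorb the
      \<open>- 1\<close> from the terms in \<open>z\<close> alone.\<close>
    have "4 * \<delta> ^ 3 \<le> 648 / 100 * \<delta>\<^sup>2"
      using mult_right_mono[OF \<delta>(2), of "\<delta>\<^sup>2"] by (simp add: power3_eq_cube power2_eq_square)
    moreover have "\<delta>\<^sup>2 \<le> 162 / 100 * \<delta>"
      using mult_right_mono[OF \<delta>(2) \<delta>(1)] by (simp add: power2_eq_square)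
    moreover have "0 \<le> z * (49 / 3 * \<delta> - 6 * \<delta>\<^sup>2)"
      using z \<delta> calculation by (intro mult_nonneg_nonneg) auto
    \<comment> \<open>7/32 is the minimiser of
      \<open>16 / 3 * z\<^sup>2 - 7 / 3 * z\<close>.\<close>
    moreover have "0 \<le> 16 / 3 * (z - 7 / 32)\<^sup>2" by simp
    then have "- 1 \<le> 16 / 3 * z\<^sup>2 - 7 / 3 * z" by (simp add: power2_eq_square algebra_simps)
    moreover have "0 \<le> z ^ 3" using z by simp
    ultimately show ?thesis using \<delta> by linarith
  qed
  ultimately have "4 * \<sigma> ^ 3 + x ^ 3 + 2 * x\<^sup>2 - x \<le> (6 * \<sigma>\<^sup>2 - 23 / 3 * \<sigma> + 13 / 3) * (x + 2)"
    by linarith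
  moreover have "real (N * (s + 2) + s) \<le> real (2 * k + s ^ 3 + 2 * s\<^sup>2)"
    using N of_nat_le_iff by blast
  then have "real N * (x + 2) \<le> 4 * \<sigma> ^ 3 + x ^ 3 + 2 * x\<^sup>2 - x"
    unfolding \<sigma>3 x_def by (simp add: algebra_simps)
  ultimately have "real N * (x + 2) \<le> (6 * \<sigma>\<^sup>2 - 23 / 3 * \<sigma> + 13 / 3) * (x + 2)" by linarith
  then have "real N \<le> 6 * \<sigma>\<^sup>2 - 23 / 3 * \<sigma> + 13 / 3" using x by simp
  with \<open>103 / 19 * (sqrt 2 * \<sigma>) \<le> 23 / 3 * \<sigma>\<close> show ?thesis
    unfolding t t2 by linarith
qed

subsection \<open>Chords of polygons on a hyperbola\<close>

lemma line_through_eq_of_mem: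
  fixes P Q :: "'a::field \<times> 'a"
  assumes "R \<in> line_through A B" "P \<in> line_through A B" "R \<noteq> P"
  shows "line_through A B = line_through R P"
proof -
  obtain r where r: "R = (fst A + r * (fst B - fst A), snd A + r * (snd B - snd A))"
    using assms(1) by (auto simp: line_through_def)
  obtain t where t: "P = (fst A + t * (fst B - fst A), snd A + t * (snd B - snd A))"
    using assms(2) by (auto simp: line_through_def)
  have "r \<noteq> t" using assms(3) r t by auto
  show ?thesis
  proof (intro Set.set_eqI iffI)
    fix X assume "X \<in> line_through A B"
    then obtain u where u: "X = (fst A + u * (fst B - fst A), snd A + u * (snd B - snd A))"
      by (auto simp: line_through_def)
    define v where "v = (u - r) / (t - r)"
    have v: "u = r + v * (t - r)" using \<open>r \<noteq> t\<close> by (simp add: v_def)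
    have "X = (fst R + v * (fst P - fst R), snd R + v * (snd P - snd R))"
      unfolding u r t v by (simp add: algebra_simps)
    then show "X \<in> line_through R P" by (auto simp: line_through_def)
  next
    fix X assume "X \<in> line_through R P"
    then obtain v where v: "X = (fst R + v * (fst P - fst R), snd R + v * (snd P - snd R))"
      by (auto simp: line_through_def)
    have "X = (fst A + (r + v * (t - r)) * (fst B - fst A), snd A + (r + v * (t - r)) * (snd B - snd A))"
      unfolding v r t by (simp add: algebra_simps)
    then show "X \<in> line_through A B" unfolding line_through_def by blast
  qed
qed

lemma endpoint_mem_line_through: "A \<in> line_through A B" "B \<in> line_through A B"
  unfolding line_through_def
  by (rule CollectI, rule exI[of _ 0], simp) (rule CollectI, rule exI[of _ 1], simp)

text \<open>A vertex different from \<open>P\<close> determines, together with \<open>P\<close>, the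
  chord containing both. Distinct chords through \<open>P\<close> therefore have disjoint vertex
  sets, each with at least two elements.\<close>

lemma twice_card_chords_le:
  fixes A :: "nat \<Rightarrow> 'a::field \<times> 'a"
  assumes inj: "inj_on A {1..k}" and P: "\<And>i. i \<in> {1..k} \<Longrightarrow> A i \<noteq> P"
  shows "2 * card {L \<in> chords k A. P \<in> L} \<le> card {i \<in> {1..k}. \<exists>L \<in> chords k A. P \<in> L \<and> A i \<in> L}"
proof -
  let ?C = "{L \<in> chords k A. P \<in> L}"
  let ?V = "\<lambda>L. {i \<in> {1..k}. A i \<in> L}"
  have "chords k A \<subseteq> (\<lambda>(i, j). line_through (A i) (A j)) ` ({1..k} \<times> {1..k})"
    unfolding chords_def by force
  then have "finite (chords k A)" by (rule finite_subset) simp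
  then have fin: "finite ?C" by simp
  have two: "2 \<le> card (?V L)" if L: "L \<in> ?C" for L
  proof -
    obtain i j where ij: "L = line_through (A i) (A j)" "1 \<le> i" "i < j" "j \<le> k"
      using L unfolding chords_def by blast
    then have "A i \<in> L" "A j \<in> L" using endpoint_mem_line_through by metis+
    with ij have "{i, j} \<subseteq> ?V L" by auto
    then have "card {i, j} \<le> card (?V L)" by (intro card_mono) auto
    then show ?thesis using ij by simp
  qed
  have disj: "?V L \<inter> ?V M = {}" if LM: "L \<in> ?C" "M \<in> ?C" "L \<noteq> M" for L M
  proof (rule ccontr)
    assume "?V L \<inter> ?V M \<noteq> {}"
    then obtain i where i: "i \<in> {1..k}" "A i \<in> L" "A i \<in> M" by auto
    have "N = line_through (A i) P" if N: "N \<in> ?C" "A i \<in> N" for N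
    proof -
      obtain a b where "N = line_through (A a) (A b)"
        using N by (auto simp: chords_def)
      then show ?thesis using N P[OF i(1)] line_through_eq_of_mem by blast
    qed
    then show False using LM i by metis
  qed
  have "2 * card ?C = (\<Sum>L\<in>?C. 2)" by simp
  also have "\<dots> \<le> (\<Sum>L\<in>?C. card (?V L))" using two by (rule sum_mono)
  also have "\<dots> = card (\<Union>L\<in>?C. ?V L)"
    by (rule card_UN_disjoint[symmetric]) (use fin disj in auto)
  also have "\<dots> \<le> card {i \<in> {1..k}. \<exists>L \<in> chords k A. P \<in> L \<and> A i \<in> L}"
    by (rule card_mono) auto
  finally show ?thesis .
qed

text \<open>In this equation the direction of a chord depends only on the product of the abscissas
  of its end points.\<close>

lemma line_through_hyperbola_points:
  fixes x y :: "'a::field"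
  assumes "x \<noteq> 0" "y \<noteq> 0" "x \<noteq> y"
  shows "(u, v) \<in> line_through (x, 1 / x) (y, 1 / y) \<longleftrightarrow> u + x * y * v = x + y"
proof
  assume "(u, v) \<in> line_through (x, 1 / x) (y, 1 / y)"
  then obtain t where t: "u = x + t * (y - x)" "v = 1 / x + t * (1 / y - 1 / x)"
    by (auto simp: line_through_def)
  then have v: "x * y * v = y + t * (x - y)" using assms by (simp add: field_simps)
  show "u + x * y * v = x + y" unfolding v unfolding t(1) by (simp add: algebra_simps)
next
  assume eq: "u + x * y * v = x + y"
  define t where "t = (u - x) / (y - x)"
  have u: "u = x + t * (y - x)" using assms by (simp add: t_def)
  have "v = 1 / x + t * (1 / y - 1 / x)"
    using eq assms unfolding u by (simp add: field_simps)
  with u show "(u, v) \<in> line_through (x, 1 / x) (y, 1 / y)"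
    by (auto simp: line_through_def)
qed

text \<open>If the products differ, the two linear equations have a common solution, so the lines
  coincide. Then \<open>x\<close> and \<open>y\<close> are the roots of T^2 - (z + w) T + z w, which
  forces equal products.\<close>

lemma parallel_hyperbola_chords:
  fixes x y z w :: "'a::field"
  assumes nz: "x \<noteq> 0" "y \<noteq> 0" "x \<noteq> y" "z \<noteq> 0" "w \<noteq> 0" "z \<noteq> w"
    and par: "parallel (line_through (x, 1 / x) (y, 1 / y)) (line_through (z, 1 / z) (w, 1 / w))"
  shows "x * y = z * w"
proof (rule ccontr)
  assume ne: "x * y \<noteq> z * w"
  define v where "v = (x + y - z - w) / (x * y - z * w)"
  define u where "u = x + y - x * y * v"
  have "v * (x * y - z * w) = x + y - z - w" using ne by (simp add: v_def)
  then have "u + x * y * v = x + y" "u + z * w * v = z + w"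
    by (auto simp: u_def algebra_simps)
  then have "(u, v) \<in> line_through (x, 1 / x) (y, 1 / y) \<inter> line_through (z, 1 / z) (w, 1 / w)"
    using line_through_hyperbola_points nz by blast
  with par have eq: "line_through (x, 1 / x) (y, 1 / y) = line_through (z, 1 / z) (w, 1 / w)"
    unfolding parallel_def by blast
  have "(x, 1 / x) \<in> line_through (z, 1 / z) (w, 1 / w)" "(y, 1 / y) \<in> line_through (z, 1 / z) (w, 1 / w)"
    unfolding eq[symmetric] by (rule endpoint_mem_line_through)+
  then have "x + z * w * (1 / x) = z + w" "y + z * w * (1 / y) = z + w"
    using line_through_hyperbola_points[OF nz(4-6)] by blast+
  then have *: "x * x + z * w = (z + w) * x" "y * y + z * w = (z + w) * y"
    using nz by (simp_all add: field_simps)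
  have "(x - y) * (x + y - (z + w)) = (x * x + z * w - (z + w) * x) - (y * y + z * w - (z + w) * y)"
    by (simp add: algebra_simps)
  then have "z + w = x + y" using * nz by simp
  with *(1) have "z * w = y * x" by (simp add: distrib_right)
  with ne show False by (simp add: mult.commute)
qed

section \<open>Parallel chords of regular polygons in the Euclidean plane\<close>

lemma line_through_same_direction:
  fixes P Q R S :: "'a::field \<times> 'a"
  assumes "Q = (fst P + \<kappa> * e, snd P + \<kappa> * f)" "S = (fst R + \<mu> * e, snd R + \<mu> * f)"
    and "\<kappa> \<noteq> 0" "\<mu> \<noteq> 0"
  shows "parallel (line_through P Q) (line_through R S)"
  unfolding parallel_def
proof (intro disjCI)
  assume "line_through P Q \<inter> line_through R S \<noteq> {}"
  then obtain X where X: "X \<in> line_through P Q" "X \<in> line_through R S" by auto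
  have mem: "Y \<in> line_through P' Q' \<longleftrightarrow> (\<exists>t. Y = (fst P' + t * e, snd P' + t * f))"
    if Q': "Q' = (fst P' + \<nu> * e, snd P' + \<nu> * f)" "\<nu> \<noteq> 0" for P' Q' Y and \<nu>
  proof
    assume "Y \<in> line_through P' Q'"
    then obtain t where "Y = (fst P' + (t * \<nu>) * e, snd P' + (t * \<nu>) * f)"
      using Q' by (auto simp: line_through_def mult.assoc)
    then show "\<exists>t. Y = (fst P' + t * e, snd P' + t * f)" by blast
  next
    assume "\<exists>t. Y = (fst P' + t * e, snd P' + t * f)"
    then obtain t where "Y = (fst P' + t * e, snd P' + t * f)" by blast
    then have "Y = (fst P' + (t / \<nu>) * (fst Q' - fst P'), snd P' + (t / \<nu>) * (snd Q' - snd P'))"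
      using Q' by simp
    then show "Y \<in> line_through P' Q'" unfolding line_through_def by blast
  qed
  obtain t where t: "X = (fst P + t * e, snd P + t * f)"
    using X(1) unfolding mem[OF assms(1,3)] by blast
  obtain t' where t': "X = (fst R + t' * e, snd R + t' * f)"
    using X(2) unfolding mem[OF assms(2,4)] by blast
  have "fst P = fst R + (t' - t) * e" "snd P = snd R + (t' - t) * f"
    using t t' by (auto simp: algebra_simps)
  then have shift: "(fst P + u * e, snd P + u * f) = (fst R + (u + (t' - t)) * e, snd R + (u + (t' - t)) * f)" for u
    by (simp add: algebra_simps)
  show "line_through P Q = line_through R S"
  proof (intro Set.set_eqI)
    fix Y
    have "(\<exists>u. Y = (fst P + u * e, snd P + u * f)) \<longleftrightarrow> (\<exists>u. Y = (fst R + u * e, snd R + u * f))"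
    proof
      assume "\<exists>u. Y = (fst P + u * e, snd P + u * f)"
      then show "\<exists>u. Y = (fst R + u * e, snd R + u * f)" using shift by blast
    next
      assume "\<exists>u. Y = (fst R + u * e, snd R + u * f)"
      then obtain u where "Y = (fst R + u * e, snd R + u * f)" by blast
      then have "Y = (fst P + (u - (t' - t)) * e, snd P + (u - (t' - t)) * f)"
        using shift[of "u - (t' - t)"] by simp
      then show "\<exists>u. Y = (fst P + u * e, snd P + u * f)" by blast
    qed
    then show "Y \<in> line_through P Q \<longleftrightarrow> Y \<in> line_through R S"
      using mem[OF assms(1,3)] mem[OF assms(2,4)] by simp
  qed
qed

text \<open>By the sum-to-product formulas a chord is orthogonal to the radius at the mean of its
  two angles, which depends only on \<open>i + j\<close>.\<close>

lemma regular_polygon_parallel: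
  assumes "regular_polygon k R" "1 \<le> i" "i < j" "j \<le> k" "1 \<le> i'" "i' < j'" "j' \<le> k"
    and sum: "i' + j' = i + j \<or> i' + j' = i + j + k"
  shows "parallel (line_through (R i) (R j)) (line_through (R i') (R j'))"
proof -
  obtain c d r \<theta> s where r: "r > 0" and s: "s = 1 \<or> s = - (1::real)"
    and R: "\<And>i. i \<in> {1..k} \<Longrightarrow> R i = (c + r * cos (\<theta> + s * (2 * pi * real i / real k)),
      d + r * sin (\<theta> + s * (2 * pi * real i / real k)))"
    using assms(1) unfolding regular_polygon_def by blast
  define \<phi> where "\<phi> m = \<theta> + s * (2 * pi * m / real k)" for m
  have k: "0 < real k" using assms by simp
  \<comment> \<open>This sine is, up to sign and a factor of twice the radius, the length of a
    chord; half the angle lies strictly between 0 and pi up to sign.\<close>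
  have diff: "sin ((\<phi> b - \<phi> a) / 2) \<noteq> 0" if "0 < b - a" "b - a < real k" for a b
  proof -
    have eq: "(\<phi> b - \<phi> a) / 2 = s * (pi * ((b - a) / real k))"
      using k by (simp add: \<phi>_def field_simps)
    have "0 < sin (pi * ((b - a) / real k))"
    proof (rule sin_gt_zero)
      have "0 < (b - a) / real k" "(b - a) / real k < 1" using that k by auto
      then show "0 < pi * ((b - a) / real k)"
        by (intro mult_pos_pos pi_gt_zero)
      show "pi * ((b - a) / real k) < pi"
        using mult_strict_left_mono[OF \<open>(b - a) / real k < 1\<close> pi_gt_zero] by simp
    qed
    then show ?thesis unfolding eq using s by auto
  qed
  define g where "g a b = - 2 * r * sin ((\<phi> b - \<phi> a) / 2)" for a b
  have step: "R b = (fst (R a) + g a b * sin ((\<phi> a + \<phi> b) / 2),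
      snd (R a) + g a b * (- cos ((\<phi> a + \<phi> b) / 2)))" if "a \<in> {1..k}" "b \<in> {1..k}" for a b :: nat
  proof -
    have "sin ((\<phi> a - \<phi> b) / 2) = - sin ((\<phi> b - \<phi> a) / 2)"
      by (metis minus_diff_eq minus_divide_left sin_minus)
    then have cosb: "cos (\<phi> b) = cos (\<phi> a) - 2 * sin ((\<phi> b - \<phi> a) / 2) * sin ((\<phi> a + \<phi> b) / 2)"
      using cos_diff_cos[of "\<phi> b" "\<phi> a"] by (simp add: algebra_simps)
    have sinb: "sin (\<phi> b) = sin (\<phi> a) + 2 * sin ((\<phi> b - \<phi> a) / 2) * cos ((\<phi> a + \<phi> b) / 2)"
      using sin_diff_sin[of "\<phi> b" "\<phi> a"] by (simp add: add.commute)
    have "r * cos (\<phi> b) = r * cos (\<phi> a) + g a b * sin ((\<phi> a + \<phi> b) / 2)"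
      "r * sin (\<phi> b) = r * sin (\<phi> a) + g a b * (- cos ((\<phi> a + \<phi> b) / 2))"
      unfolding g_def cosb sinb by (simp_all add: algebra_simps)
    then show ?thesis using R[OF that(1)] R[OF that(2)] by (simp add: \<phi>_def)
  qed
  let ?m = "(\<phi> i + \<phi> j) / 2" and ?m' = "(\<phi> i' + \<phi> j') / 2"
  \<comment> \<open>Raising the index sum by \<open>k\<close> turns the mean angle by pi, which
    merely reverses the direction vector.\<close>
  have "?m' = ?m \<or> ?m' = ?m + s * pi"
  proof -
    have eq: "?m' = ?m + s * pi * ((real (i' + j') - real (i + j)) / real k)"
      using k by (simp add: \<phi>_def field_simps)
    from sum show ?thesis
    proof
      assume "i' + j' = i + j"
      then have "real (i' + j') - real (i + j) = 0" by simp
      then have "?m' = ?m" unfolding eq by simp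
      then show ?thesis ..
    next
      assume "i' + j' = i + j + k"
      then have "(real (i' + j') - real (i + j)) / real k = 1" using k by simp
      then have "?m' = ?m + s * pi" unfolding eq by simp
      then show ?thesis ..
    qed
  qed
  then obtain \<epsilon> where \<epsilon>: "\<epsilon> \<noteq> 0" "sin ?m' = \<epsilon> * sin ?m" "cos ?m' = \<epsilon> * cos ?m"
  proof
    assume eq: "?m' = ?m + s * pi"
    have "sin (y + s * pi) = - 1 * sin y" "cos (y + s * pi) = - 1 * cos y" for y
      using s by (auto simp: sin_diff cos_diff)
    then have "sin ?m' = - 1 * sin ?m" "cos ?m' = - 1 * cos ?m"
      by (simp_all only: eq)
    then show thesis by (intro that[of "- 1"]) auto
  next
    assume eq: "?m' = ?m"
    show thesis by (rule that[of 1]) (simp_all only: eq mult_1 one_neq_zero not_False_eq_True)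
  qed
  have "g i j \<noteq> 0" "g i' j' \<noteq> 0"
    using diff[of "real j" "real i"] diff[of "real j'" "real i'"] assms r by (auto simp: g_def)
  then show ?thesis
    using step[of i j] step[of i' j'] assms \<epsilon>
    by (intro line_through_same_direction[where e = "sin ?m" and f = "- cos ?m" and \<kappa> = "g i j" and \<mu> = "g i' j' * \<epsilon>"])
      (auto simp: mult.assoc)
qed

section \<open>Abscissas of an inscribed affinely regular polygon\<close>

lemma unit_hyperbola_point:
  assumes "P \<in> unit_hyperbola"
  shows "P = (fst P, 1 / fst P)" and "fst P \<noteq> 0"
proof -
  have prod: "fst P * snd P = 1"
    using assms by (auto simp: unit_hyperbola_def)
  then show "fst P \<noteq> 0" by auto
  with prod have "snd P = 1 / fst P" by (simp add: field_simps)
  then show "P = (fst P, 1 / fst P)" by (simp add: prod_eq_iff)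
qed

text \<open>Products of abscissas agree whenever the index sums are equal or differ by
  \<open>k\<close>. Equal sums yield a geometric progression with ratio \<open>\<zeta>\<close>, and
  one comparison around the cycle yields \<open>\<zeta> ^ k = 1\<close>.\<close>

lemma affinely_regular_abscissa_powers:
  fixes A :: "nat \<Rightarrow> 'a::field \<times> 'a"
  assumes "affinely_regular k A" and hyp: "\<forall>i\<in>{1..k}. A i \<in> unit_hyperbola" and k: "5 \<le> k"
  obtains c where "c \<noteq> 0" "\<And>i. i \<in> {1..k} \<Longrightarrow> fst (A i) ^ k = c"
proof -
  define x where "x i = fst (A i)" for i
  obtain R where R: "regular_polygon k R"
    and par: "\<And>i0 j0 i1 j1. 1 \<le> i0 \<Longrightarrow> i0 < j0 \<Longrightarrow> j0 \<le> k \<Longrightarrow> 1 \<le> i1 \<Longrightarrow> i1 < j1 \<Longrightarrow> j1 \<le> k \<Longrightarrow>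
        parallel (line_through (R i0) (R j0)) (line_through (R i1) (R j1)) \<Longrightarrow>
        parallel (line_through (A i0) (A j0)) (line_through (A i1) (A j1))"
    using assms(1) unfolding affinely_regular_def by blast
  have inj: "inj_on A {1..k}"
    using assms(1) by (simp add: affinely_regular_def polygon_def)
  have A: "A i = (x i, 1 / x i)" "x i \<noteq> 0" if "i \<in> {1..k}" for i
    unfolding x_def using unit_hyperbola_point hyp that by blast+
  have ne: "x i \<noteq> x j" if "i \<in> {1..k}" "j \<in> {1..k}" "i \<noteq> j" for i j
    using that inj A by (metis inj_onD)
  have rel: "x i * x j = x i' * x j'"
    if "1 \<le> i" "i < j" "j \<le> k" "1 \<le> i'" "i' < j'" "j' \<le> k" "i' + j' = i + j \<or> i' + j' = i + j + k"
    for i j i' j'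
  proof -
    have "parallel (line_through (A i) (A j)) (line_through (A i') (A j'))"
      using par regular_polygon_parallel[OF R] that by blast
    then show ?thesis
      using A[of i] A[of j] A[of i'] A[of j'] ne[of i j] ne[of i' j'] that
      by (intro parallel_hyperbola_chords) auto
  qed
  define \<zeta> where "\<zeta> = x 2 / x 1"
  have x2: "x 2 = x 1 * \<zeta>" using A(2)[of 1] k by (simp add: \<zeta>_def)
  \<comment> \<open>The chords \<open>(2, l)\<close> and \<open>(1, l + 1)\<close> are compared; at
    \<open>l = 2\<close> the first degenerates, so this ratio is treated separately.\<close>
  have step: "x (Suc l) = x l * \<zeta>" if "l = 1 \<or> 3 \<le> l" "Suc l \<le> k" for l
    using that(1)
  proof
    assume "3 \<le> l"
    then have "x 2 * x l = x 1 * x (Suc l)" using that by (intro rel) auto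
    from this[symmetric] have "x 1 * x (Suc l) = x 1 * (x l * \<zeta>)"
      unfolding x2 by (simp add: mult_ac)
    then show ?thesis using A(2)[of 1] k by simp
  qed (use x2 in \<open>simp add: numeral_2_eq_2\<close>)
  \<comment> \<open>The missing ratio from vertex 2 to vertex 3 comes from vertices 2 to 5; this is
    where \<open>k \<ge> 5\<close> enters.\<close>
  have "x 3 * x 4 = x 2 * x 5" using k by (intro rel) auto
  moreover have "x 5 = x 4 * \<zeta>" using step[of 4] k by simp
  ultimately have x3: "x 3 = x 2 * \<zeta>" using A(2)[of 4] k by auto
  have geo: "x (Suc l) = x 1 * \<zeta> ^ l" if "Suc l \<le> k" for l
    using that
  proof (induction l)
    case (Suc l)
    show ?case
    proof (cases "l = 1")
      case True
      then show ?thesis using x3 x2 by (simp add: numeral_3_eq_3 numeral_2_eq_2)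
    next
      case False
      then have "x (Suc (Suc l)) = x (Suc l) * \<zeta>" using Suc.prems by (intro step) auto
      then show ?thesis using Suc by simp
    qed
  qed simp
  \<comment> \<open>The index sums 3 and \<open>3 + k\<close> differ by \<open>k\<close>, which
    closes the cycle.\<close>
  have "x 1 * x 2 = x 3 * x k" using k by (intro rel) auto
  moreover have "x k = x 1 * \<zeta> ^ (k - 1)" using geo[of "k - 1"] k by simp
  moreover have "x 3 = x 1 * \<zeta> ^ 2" using x2 x3 by (simp add: power2_eq_square)
  moreover have "\<zeta> \<noteq> 0" using x2 A(2)[of 2] k by auto
  moreover have "x 1 \<noteq> 0" using A(2)[of 1] k by simp
  moreover have "\<zeta> ^ k = \<zeta> * \<zeta> ^ (k - 1)" using k by (cases k) auto
  ultimately have root: "\<zeta> ^ k = 1"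
    unfolding x2 by (simp add: power2_eq_square)
  show thesis
  proof (rule that)
    show "x 1 ^ k \<noteq> 0" using \<open>x 1 \<noteq> 0\<close> by simp
    fix i assume "i \<in> {1..k}"
    then have "x i = x 1 * \<zeta> ^ (i - 1)" using geo[of "i - 1"] by auto
    then have "x i ^ k = x 1 ^ k * (\<zeta> ^ k) ^ (i - 1)"
      by (simp add: power_mult_distrib mult.commute flip: power_mult)
    then show "fst (A i) ^ k = x 1 ^ k" using root by (simp add: x_def)
  qed
qed

text \<open>The chord equation solved for \<open>x - a\<close> is
  \<open>y * b * (x - 1 / b)\<close>; taking \<open>k\<close>-th powers eliminates
  \<open>y\<close>.\<close>

lemma chord_through_point_abscissa:
  fixes x y :: "'a::field"
  assumes "x \<noteq> 0" "y \<noteq> 0" "x \<noteq> y" "b \<noteq> 0" "(a, b) \<in> line_through (x, 1 / x) (y, 1 / y)" "y ^ k = c"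
  shows "(x - a) ^ k = c * b ^ k * (x - 1 / b) ^ k"
proof -
  have "a + x * y * b = x + y"
    using assms line_through_hyperbola_points by blast
  then have "x - a = x * y * b - y" by (simp add: algebra_simps)
  also have "\<dots> = y * (b * (x - 1 / b))"
    using assms by (simp add: algebra_simps)
  finally show ?thesis
    using assms(6) by (simp only: power_mult_distrib mult.assoc)
qed

section \<open>The characteristic, polygons with few vertices, and the conclusion\<close>

lemma of_nat_nonzero_below_card:
  assumes "prime (CARD('a::{field, finite}))" "0 < i" "i < CARD('a)"
  shows "of_nat i \<noteq> (0::'a)"
proof
  assume i: "of_nat i = (0::'a)"
  \<comment> \<open>Translation by 1 permutes the field; comparing the sums of all elements shows
    that the cardinality is 0 in the field.\<close>
  have "(\<Sum>x\<in>(UNIV::'a set). x) = (\<Sum>x\<in>(UNIV::'a set). x + 1)"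
    by (rule sum.reindex_bij_witness[of _ "\<lambda>x. x + 1" "\<lambda>x. x - 1"]) auto
  then have p: "of_nat (CARD('a)) = (0::'a)"
    by (simp add: sum.distrib)
  have "\<not> CARD('a) dvd i"
    using assms by (auto dest: dvd_imp_le)
  then have "gcd i (CARD('a)) = 1"
    using assms(1) by (metis prime_imp_coprime coprime_imp_gcd_eq_1 gcd.commute)
  then obtain u v where "i * u = CARD('a) * v + 1"
    using bezout_nat[of i "CARD('a)"] assms(2) by auto
  then have "of_nat (i * u) = (of_nat (CARD('a) * v + 1) :: 'a)" by simp
  then show False using i p by simp
qed

text \<open>For \<open>k \<le> 4\<close> disjointness of the end points alone is enough; three cases
  for \<open>m\<close> remain.\<close>

lemma small_polygon_numeric:
  assumes "2 * m \<le> k" "k \<le> 4"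
  shows "real (2 * m) \<le> 3 * (sqrt 2 * real k) powr (2 / 3)
    - 103 / 19 * (sqrt 2 * real k) powr (1 / 3) + 13 / 3"
proof -
  define t where "t = (sqrt 2 * real k) powr (1 / 3)"
  have t0: "0 \<le> t" by (simp add: t_def)
  have t3: "t ^ 3 = sqrt 2 * real k"
  proof (cases "k = 0")
    case False
    then have "0 < t" by (simp add: t_def)
    then have "t ^ 3 = t powr 3" using powr_realpow[of t 3] by simp
    also have "\<dots> = sqrt 2 * real k" unfolding t_def powr_powr by simp
    finally show ?thesis .
  qed (simp add: t_def)
  have t2: "(sqrt 2 * real k) powr (2 / 3) = t\<^sup>2"
  proof (cases "k = 0")
    case False
    then have "0 < t" by (simp add: t_def)
    then have "t\<^sup>2 = t powr 2" using powr_realpow[of t 2] by simp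
    also have "\<dots> = (sqrt 2 * real k) powr (2 / 3)" unfolding t_def powr_powr by simp
    finally show ?thesis by simp
  qed (simp add: t_def)
  have root: "u \<le> t" if "u ^ 3 \<le> t ^ 3" for u
  proof (rule ccontr)
    assume "\<not> u \<le> t"
    then have "t ^ 3 < u ^ 3" using t0 by (intro power_strict_mono) auto
    with that show False by simp
  qed
  have sqrt2: "14 / 10 \<le> sqrt 2" by (rule real_le_rsqrt) (simp add: power2_eq_square)
  have "real (2 * m) \<le> 3 * t\<^sup>2 - 103 / 19 * t + 13 / 3"
  proof -
    consider "m = 0" | "m = 1" "2 \<le> k" | "m = 2" "k = 4" using assms by linarith
    then show ?thesis
    proof cases
      case 1
      \<comment> \<open>103/114 is the minimiser of the quadratic in \<open>t\<close>.\<close>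
      have "0 \<le> 3 * (t - 103 / 114)\<^sup>2" by simp
      then show ?thesis using 1 t0 by (simp add: power2_eq_square algebra_simps)
    next
      case 2
      have "14 / 10 * 2 \<le> sqrt 2 * real k" using sqrt2 2 by (intro mult_mono) auto
      \<comment> \<open>7/5, and 7/4 in the next case, are rational lower bounds for the cube root,
        sharp enough to reach 2 and 4.\<close>
      then have "7 / 5 \<le> t" by (intro root, unfold t3) (simp add: power3_eq_cube)
      moreover have "0 \<le> (t - 7 / 5)\<^sup>2" by simp
      ultimately show ?thesis using 2 by (simp add: power2_eq_square algebra_simps)
    next
      case 3
      have "14 / 10 * 4 \<le> sqrt 2 * real k" using sqrt2 3 by (intro mult_mono) auto
      then have "7 / 4 \<le> t" by (intro root, unfold t3) (simp add: power3_eq_cube)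
      moreover have "0 \<le> (t - 7 / 4)\<^sup>2" by simp
      ultimately show ?thesis using 3 by (simp add: power2_eq_square algebra_simps)
    qed
  qed
  then show ?thesis by (simp only: t2 t_def)
qed

theorem corollary4p2:
  fixes A :: "nat \<Rightarrow> 'a::{field, finite} \<times> 'a"
    and a b :: 'a
    and p n k :: nat
  assumes "prime p" and "CARD('a) = p"
    and "n \<ge> 3" and "n dvd p - 1" and "n \<noteq> p - 1"
    and "k = (p - 1) div n"
    and "affinely_regular k A"
    and "\<forall>i\<in>{1..k}. A i \<in> unit_hyperbola"
    and "a * b \<notin> {0, 1}"
    and "real p - 1 \<le>
           real n * ((real n + 3) * (real n + 4) * (3 * real n - 1) / 12 - 3)"
  shows "real (card {L \<in> chords k A. (a, b) \<in> L}) \<le>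
           1 / 2 * (3 * (sqrt 2 * real k) powr (2 / 3)
                    - 103 / 19 * (sqrt 2 * real k) powr (1 / 3) + 13 / 3)"
proof -
  let ?m = "card {L \<in> chords k A. (a, b) \<in> L}"
  let ?V = "{i \<in> {1..k}. \<exists>L \<in> chords k A. (a, b) \<in> L \<and> A i \<in> L}"
  let ?bound = "3 * (sqrt 2 * real k) powr (2 / 3)
    - 103 / 19 * (sqrt 2 * real k) powr (1 / 3) + 13 / 3"
  have ab: "a \<noteq> 0" "b \<noteq> 0" "a \<noteq> 1 / b" using assms(9) by auto
  have inj: "inj_on A {1..k}"
    using assms(7) by (simp add: affinely_regular_def polygon_def)
  have A: "A i = (fst (A i), 1 / fst (A i))" "fst (A i) \<noteq> 0" if "i \<in> {1..k}" for i
    using unit_hyperbola_point assms(8) that by blast+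
  have inj_fst: "inj_on (\<lambda>i. fst (A i)) {1..k}"
  proof (rule inj_onI)
    fix i j assume *: "i \<in> {1..k}" "j \<in> {1..k}" "fst (A i) = fst (A j)"
    then have "A i = A j" using A(1)[of i] A(1)[of j] by simp
    then show "i = j" using inj * by (auto dest: inj_onD)
  qed
  have "A i \<noteq> (a, b)" if "i \<in> {1..k}" for i
    using assms(8,9) that by (force simp: unit_hyperbola_def)
  with inj have mV: "2 * ?m \<le> card ?V" by (rule twice_card_chords_le)
  have "real (2 * ?m) \<le> ?bound"
  proof (cases "k \<le> 4")
    case True
    have "card ?V \<le> card {1..k}" by (rule card_mono) auto
    with mV have "2 * ?m \<le> k" by simp
    then show ?thesis using True by (rule small_polygon_numeric)
  next
    case False
    then have k: "5 \<le> k" by simp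
    obtain c where c: "c \<noteq> 0" "\<And>i. i \<in> {1..k} \<Longrightarrow> fst (A i) ^ k = c"
      using affinely_regular_abscissa_powers[OF assms(7,8) k] by blast
    define S where "S = {x. x ^ k = c \<and> (x - a) ^ k = c * b ^ k * (x - 1 / b) ^ k}"
    have "fst (A i) \<in> S" if V: "i \<in> ?V" for i
    proof -
      obtain u v where uv: "1 \<le> u" "u < v" "v \<le> k" "(a, b) \<in> line_through (A u) (A v)"
        "A i \<in> line_through (A u) (A v)" and i: "i \<in> {1..k}"
        using V by (auto simp: chords_def)
      define x y z where "x = fst (A u)" and "y = fst (A v)" and "z = fst (A i)"
      have Au: "A u = (x, 1 / x)" "x \<noteq> 0" "x ^ k = c"
        using A[of u] c(2)[of u] uv by (auto simp: x_def)
      have Av: "A v = (y, 1 / y)" "y \<noteq> 0" "y ^ k = c"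
        using A[of v] c(2)[of v] uv by (auto simp: y_def)
      have Ai: "A i = (z, 1 / z)" "z \<noteq> 0"
        using A[OF i] by (auto simp: z_def)
      have "x \<noteq> y"
        using inj_onD[OF inj_fst, of u v] uv by (auto simp: x_def y_def)
      \<comment> \<open>\<open>?V\<close> contains every vertex on a chord through the point; a line
        meets the hyperbola at most twice, so \<open>z\<close> is one of the end points
        \<open>x\<close>, \<open>y\<close>.\<close>
      have "z + x * y * (1 / z) = x + y"
        using uv(5) line_through_hyperbola_points[OF Au(2) Av(2) \<open>x \<noteq> y\<close>]
        by (simp only: Au(1) Av(1) Ai(1))
      then have "z * z + x * y = (x + y) * z" using Ai(2) by (simp add: field_simps)
      then have "(z - x) * (z - y) = 0" by (simp add: algebra_simps)
      moreover have "x \<in> S"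
        using chord_through_point_abscissa[of x y b a k c] uv(4) Au Av \<open>x \<noteq> y\<close> ab by (simp add: S_def)
      moreover have "y \<in> S"
      proof -
        have "(a, b) \<in> line_through (y, 1 / y) (x, 1 / x)"
          using uv(4) Au Av \<open>x \<noteq> y\<close> line_through_hyperbola_points[of x y] line_through_hyperbola_points[of y x]
          by (simp add: mult.commute add.commute)
        then show ?thesis
          using chord_through_point_abscissa[of y x b a k c] Au Av \<open>x \<noteq> y\<close> ab by (simp add: S_def)
      qed
      ultimately have "z \<in> S" by auto
      then show ?thesis by (simp add: z_def)
    qed
    then have "card ?V \<le> card S"
      by (intro card_inj_on_le[of "\<lambda>i. fst (A i)"]) (use inj_fst in \<open>auto intro: inj_on_subset\<close>)
    have p: "p - 1 = n * k" using assms(4,6) by simp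
    have "2 \<le> p" using assms(1) by (rule prime_ge_2_nat)
    have "real n * real k = real p - 1"
      using p \<open>2 \<le> p\<close> by (simp flip: of_nat_mult add: of_nat_diff)
    with assms(10) have "real n * real k \<le> real n * ((real n + 3) * (real n + 4) * (3 * real n - 1) / 12 - 3)"
      by simp
    moreover define E where "E = (real n + 3) * (real n + 4) * (3 * real n - 1)"
    ultimately have "real k \<le> E / 12 - 3"
      using assms(3) by (simp only: mult_le_cancel_left_pos)
    then have "12 * (real k + 3) \<le> E" by simp
    moreover have sub: "real (3 * n - 1) = 3 * real n - 1" using assms(3) by (simp add: of_nat_diff)
    have "real ((n + 3) * (n + 4) * (3 * n - 1)) = E"
      unfolding E_def by (simp only: of_nat_mult of_nat_add of_nat_numeral sub)
    ultimately have "real (12 * (k + 3)) \<le> real ((n + 3) * (n + 4) * (3 * n - 1))"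
      by (simp only: of_nat_mult of_nat_add of_nat_numeral)
    then have twelve: "12 * (k + 3) \<le> (n + 3) * (n + 4) * (3 * n - 1)" by (simp only: of_nat_le_iff)
    obtain s where s: "1 \<le> s" "2 * s \<le> n" "s < k"
      "3 * (k + 3) \<le> (s + 2) * (2 * s + 5) * (3 * s + 1)"
      "s = 1 \<or> (s + 1) * (2 * s + 3) * (3 * s - 2) < 3 * (k + 3)"
      by (rule exists_box_size[OF assms(3) k twelve])
    \<comment> \<open>\<open>2 * s \<le> n\<close> keeps all degrees at most
      \<open>n * k = p - 1\<close>, hence below the characteristic.\<close>
    have "2 * (s * k) \<le> n * k" using s(2) by (simp flip: mult.assoc)
    then have "2 * (s * k) < p" using p \<open>2 \<le> p\<close> by linarith
    have char: "of_nat i \<noteq> (0::'a)" if "0 < i" "i \<le> 2 * (s * k)" for i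
      by (rule of_nat_nonzero_below_card) (use assms(1,2) that \<open>2 * (s * k) < p\<close> in auto)
    have bound: "card S * (s + 2) + s \<le> 2 * k + s ^ 3 + 2 * s\<^sup>2"
      by (rule card_coset_pairs_bound[of a "1 / b" c "c * b ^ k"]) (use ab c(1) s char in \<open>auto simp: S_def\<close>)
    have "real (card S) \<le> ?bound"
      by (rule box_bound_numeric[OF k s(1) s(4) s(5) bound])
    then show ?thesis using mV \<open>card ?V \<le> card S\<close> by simp
  qed
  then show ?thesis by simp
qed

end
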